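(* Let $\{T_n; n\ge 1\}$ and $\{Y_n; n\ge 1\}$ be two sequences of non-negative negatively associated (NA) random variables, and suppose that the sequences $\{T_n;n\ge1\}$ and $\{Y_n;n\ge1\}$ are independent of each other. Suppose the $T_i$ have common continuous marginal distribution function $F$ with density $f$, and the $Y_i$ have common marginal distribution function $G$ with density $g=G'$. Assume that the kernel density $k$ has bounded variation on some finite interval $(r,s)$, with $k(t)=0$ for $t\notin(r,s)$, where $-\infty<r<0<s<\infty$. Suppose that $f$ and $g$ are bounded on the closed interval $[0,\tau]$ for some $\tau\in(a_F,\tau_L)$. Let $\{b_n;n\ge1\}$ be a sequence of positive bandwidths with $b_n\to0$ and $b_n^{-1}=o\big((n/\ln n)^{1/2}\big)$. Then $$\sup_{0<t\le\tau}\left|\tilde f_n(t)-f_n(t)-\frac{f_n^*(t)-E f_n^*(t)}{1-G(t)}\right|=O\big(b_n^{-1}(n^{-1}\ln n)^{1/2}\big)\quad\text{a.s.}$$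
   Context: Negative association: a finite family $T_1,\dots,T_n$ of random variables is NA if for every pair of disjoint subsets $B_1,B_2$ of $\{1,\dots,n\}$, $\operatorname{cov}(f_1(T_i;i\in B_1),f_2(T_j;j\in B_2))\le0$ whenever $f_1,f_2$ are both increasing in every variable (or both decreasing in every variable) and the covariance exists. An infinite sequence is NA if every finite subfamily is NA. Censored data: one observes $X_i=\min(T_i,Y_i)$ and $\delta_i=I(T_i\le Y_i)$, $i=1,\dots,n$, where $I(A)$ is the indicator of $A$. $L$ denotes the common distribution function of the $X_i$, so that $1-L=(1-F)(1-G)$. For a distribution function $D$, $a_D=\inf\{t:D(t)>0\}$ and $\tau_D=\sup\{t:D(t)<1\}$; in particular $\tau_L=\min(\tau_F,\tau_G)$. Kaplan-Meier estimator: let $N_n(t)=\sum_{i=1}^n I(X_i\le t,\delta_i=1)$ and $dN_n(t)=N_n(t)-N_n(t-)$. The estimator $\hat F_n$ of $F$ is defined by $$1-\hat F_n(x)=\prod_{t\le x}\left(1-\frac{dN_n(t)}{\#\{i\le n: X_i\ge t\}}\right),$$ the product being over the finitely many $t\le x$ with $dN_n(t)>0$. In the absence of ties this is $\prod_{X_{(j)}\le x}\big(1-\frac{\delta_{(j)}}{n-j+1}\big)$, where $X_{(1)}\le\dots\le X_{(n)}$ are the order statistics of $X_1,\dots,X_n$ and $\delta_{(j)}$ is the censoring indicator associated with $X_{(j)}$. Kernel quantities: $k$ is a (smoothing) probability kernel function, i.e. a probability density on $\mathbb R$, and $$\tilde f_n(t)=b_n^{-1}\int_{a_F}^{+\infty}k\Big(\frac{t-x}{b_n}\Big)\,d\hat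 F_n(x),\qquad f_n(t)=b_n^{-1}\int_{a_F}^{+\infty}k\Big(\frac{t-x}{b_n}\Big)\,dF(x),$$ $$f_n^*(t)=b_n^{-1}\int_{a_F}^{+\infty}k\Big(\frac{t-x}{b_n}\Big)\,dF_{*n}(x),\qquad F_{*n}(x)=\frac1n\sum_{i=1}^n I(X_i\le x,\ \delta_i=1).$$ "$Z_n=O(a_n)$ a.s." means $\limsup_{n\to\infty}|Z_n|/a_n<\infty$ almost surely. *)

theory Defs
  imports "HOL-Probability.Probability" "HOL-Library.Landau_Symbols"
begin

text \<open>
  For functions of \<open>(T i)\<^sub>i\<^sub>\<in>\<^sub>B\<close>, ``increasing in every variable'' is monotonicity for the
  pointwise order on the product space of extensional functions \<open>B \<rightarrow>\<^sub>E UNIV\<close>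
  (weak monotonicity, as is usual for negative association).
  The covariance exists when both variables and their product are integrable.
\<close>

definition covariance_exists :: "'a measure \<Rightarrow> ('a \<Rightarrow> real) \<Rightarrow> ('a \<Rightarrow> real) \<Rightarrow> bool" where
  "covariance_exists M U V \<longleftrightarrow>
     integrable M U \<and> integrable M V \<and> integrable M (\<lambda>\<omega>. U \<omega> * V \<omega>)"

definition covariance :: "'a measure \<Rightarrow> ('a \<Rightarrow> real) \<Rightarrow> ('a \<Rightarrow> real) \<Rightarrow> real" where
  "covariance M U V =
     (LINT \<omega>|M. (U \<omega> - (LINT \<omega>'|M. U \<omega>')) * (V \<omega> - (LINT \<omega>'|M. V \<omega>')))"

definition neg_assoc_family :: "'a measure \<Rightarrow> 'i set \<Rightarrow> ('i \<Rightarrow> 'a \<Rightarrow> real) \<Rightarrow> bool" where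
  "neg_assoc_family M I T \<longleftrightarrow>
     (\<forall>B1 B2 f1 f2.
        B1 \<subseteq> I \<longrightarrow> B2 \<subseteq> I \<longrightarrow> B1 \<inter> B2 = {} \<longrightarrow>
        f1 \<in> borel_measurable (Pi\<^sub>M B1 (\<lambda>_. borel)) \<longrightarrow>
        f2 \<in> borel_measurable (Pi\<^sub>M B2 (\<lambda>_. borel)) \<longrightarrow>
        (mono_on (B1 \<rightarrow>\<^sub>E UNIV) f1 \<and> mono_on (B2 \<rightarrow>\<^sub>E UNIV) f2 \<or>
         antimono_on (B1 \<rightarrow>\<^sub>E UNIV) f1 \<and> antimono_on (B2 \<rightarrow>\<^sub>E UNIV) f2) \<longrightarrow>
        covariance_exists M (\<lambda>\<omega>. f1 (\<lambda>i\<in>B1. T i \<omega>)) (\<lambda>\<omega>. f2 (\<lambda>j\<in>B2. T j \<omega>)) \<longrightarrow>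
        covariance M (\<lambda>\<omega>. f1 (\<lambda>i\<in>B1. T i \<omega>)) (\<lambda>\<omega>. f2 (\<lambda>j\<in>B2. T j \<omega>)) \<le> (0::real))"

text \<open>Sequences are indexed from 1; the entry at index 0 is never used.\<close>

definition neg_assoc_seq :: "'a measure \<Rightarrow> (nat \<Rightarrow> 'a \<Rightarrow> real) \<Rightarrow> bool" where
  "neg_assoc_seq M T \<longleftrightarrow> (\<forall>I. finite I \<longrightarrow> I \<subseteq> {1..} \<longrightarrow> neg_assoc_family M I T)"

definition lower_end :: "(real \<Rightarrow> real) \<Rightarrow> ereal" where
  "lower_end D = Inf {ereal t | t. 0 < D t}"

definition upper_end :: "(real \<Rightarrow> real) \<Rightarrow> ereal" where
  "upper_end D = Sup {ereal t | t. D t < 1}"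

context
  fixes T Y :: "nat \<Rightarrow> 'a \<Rightarrow> real"
begin

definition obs_time :: "nat \<Rightarrow> 'a \<Rightarrow> real" where
  "obs_time i \<omega> = min (T i \<omega>) (Y i \<omega>)"

definition cens_ind :: "nat \<Rightarrow> 'a \<Rightarrow> nat" where
  "cens_ind i \<omega> = of_bool (T i \<omega> \<le> Y i \<omega>)"

definition num_events :: "nat \<Rightarrow> 'a \<Rightarrow> real \<Rightarrow> real" where
  "num_events n \<omega> t = (\<Sum>i=1..n. of_bool (obs_time i \<omega> \<le> t \<and> cens_ind i \<omega> = 1))"

definition jump_events :: "nat \<Rightarrow> 'a \<Rightarrow> real \<Rightarrow> real" where
  "jump_events n \<omega> t = num_events n \<omega> t - Lim (at_left t) (num_events n \<omega>)"

definition num_at_risk :: "nat \<Rightarrow> 'a \<Rightarrow> real \<Rightarrow> nat" where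
  "num_at_risk n \<omega> t = card {i \<in> {1..n}. t \<le> obs_time i \<omega>}"

definition kaplan_meier :: "nat \<Rightarrow> 'a \<Rightarrow> real \<Rightarrow> real" where
  "kaplan_meier n \<omega> x =
     1 - (\<Prod>t | t \<le> x \<and> 0 < jump_events n \<omega> t.
            1 - jump_events n \<omega> t / real (num_at_risk n \<omega> t))"

definition sub_empirical :: "nat \<Rightarrow> 'a \<Rightarrow> real \<Rightarrow> real" where
  "sub_empirical n \<omega> x =
     (\<Sum>i=1..n. of_bool (obs_time i \<omega> \<le> x \<and> cens_ind i \<omega> = 1)) / real n"

end

definition prob_density :: "(real \<Rightarrow> real) \<Rightarrow> bool" where
  "prob_density k \<longleftrightarrow>
     k \<in> borel_measurable borel \<and> (\<forall>x. 0 \<le> k x) \<and> (\<integral>\<^sup>+x. ennreal (k x) \<partial>lborel) = 1"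

definition bounded_variation_on :: "real set \<Rightarrow> (real \<Rightarrow> real) \<Rightarrow> bool" where
  "bounded_variation_on S k \<longleftrightarrow>
     (\<exists>C. \<forall>m (x :: nat \<Rightarrow> real). x ` {..m} \<subseteq> S \<longrightarrow> mono_on {..m} x \<longrightarrow>
        (\<Sum>i<m. \<bar>k (x (Suc i)) - k (x i)\<bar>) \<le> C)"

text \<open>
  \<open>kernel_smooth k b a D t\<close> is the Lebesgue--Stieltjes integral
  \<open>b\<^sup>-\<^sup>1 \<integral> k ((t - x) / b) dD(x)\<close> over \<open>a \<le> x < \<infinity>\<close>, for \<open>D\<close> nondecreasing and
  right-continuous. The lower limit is included.
\<close>

definition kernel_smooth :: "(real \<Rightarrow> real) \<Rightarrow> real \<Rightarrow> ereal \<Rightarrow> (real \<Rightarrow> real) \<Rightarrow> real \<Rightarrow> real" where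
  "kernel_smooth k b a D t =
     inverse b * (LINT x:{x. a \<le> ereal x}|interval_measure D. k ((t - x) / b))"

text \<open>
  Extended-real valued \<open>Z\<close>, so that a supremum that is infinite for infinitely many
  \<open>n\<close> violates the bound.
\<close>

definition as_bigo :: "'a measure \<Rightarrow> (nat \<Rightarrow> 'a \<Rightarrow> ereal) \<Rightarrow> (nat \<Rightarrow> real) \<Rightarrow> bool" where
  "as_bigo M Z a \<longleftrightarrow> (AE \<omega> in M. limsup (\<lambda>n. \<bar>Z n \<omega>\<bar> / ereal (a n)) < \<infinity>)"

end

theory Submission
  imports Defs "HOL-Real_Asymp.Real_Asymp"
begin

text \<open>
  Each of the two differences in the theorem, \<open>ftilde - fn\<close> and \<open>fstar - E fstar\<close>, is of the
  claimed order on its own, so it suffices to bound them separately. A kernel of bounded variation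
  turns uniform distances into kernel distances: integrating \<open>k ((t - x) / b)\<close> against the
  difference of two measures gives at most a constant times the largest gap of their distribution
  functions on \<open>{..t - r b}\<close> (\<open>kernel_integral_discrepancy\<close>). Fix \<open>u > \<tau>\<close> with \<open>L u < 1\<close>. As
  \<open>b n\<close> tends to 0, the windows of all \<open>t \<le> \<tau>\<close> eventually lie in \<open>{..u}\<close>, and what remains is
  to show that, almost surely and uniformly on \<open>{..u}\<close>, the distribution function of the observed
  events is within \<open>O(sqrt (ln n / n))\<close> of its mean and the Kaplan-Meier estimator is within
  \<open>O(sqrt (ln n / n))\<close> of \<open>F\<close>.

  The second claim follows from the first and the same bound for the proportion at risk, by a
  deterministic comparison (\<open>kaplan_meier_discrepancy\<close>). Up to squares of the jumps, the logarithm
  of the product-limit estimator is minus the integral of the inverse proportion at risk against the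
  measure of observed events. The limiting counterpart is
  \<open>- ln (1 - F x) = \<integral>\<^bsub>{..x}\<^esub> 1 / ((1 - F) (1 - G)) d\<nu>\<close>, where \<open>\<nu>\<close> is the law of an uncensored
  lifetime, and both integrals are close because \<open>1 / ((1 - F) (1 - G))\<close> is monotone. Ties need no
  separate treatment: since \<open>\<nu>\<close> has no atoms, a jump is at most twice the uniform distance.

  The uniform rates come from an exponential inequality. Negative association bounds the moment
  generating function of a sum of equally directed functions by the product of the individual ones,
  which gives Hoeffding's inequality (\<open>neg_assoc_hoeffding\<close>). The event \<open>T \<le> x, T \<le> Y\<close> is
  decreasing in \<open>T\<close> but increasing in \<open>Y\<close>, so the pairs are treated in two steps
  (\<open>neg_assoc_pair_hoeffding\<close>): given the \<open>Y\<close>'s, the sum consists of monotone functions of the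
  \<open>T\<close>'s, and its conditional mean is again a sum of monotone functions of the \<open>Y\<close>'s. A grid of
  quantiles and the Borel-Cantelli lemma make the bound uniform
  (\<open>uniform_rate_of_pointwise_tails\<close>).
\<close>

section \<open>Integrals against measures with close distribution functions\<close>

lemma cdf_discrepancy_open_half_line:
  assumes \<mu>: "finite_borel_measure \<mu>" and \<nu>: "finite_borel_measure \<nu>"
    and close: "\<And>x. x \<le> u \<Longrightarrow> \<bar>cdf \<mu> x - cdf \<nu> x\<bar> \<le> e"
    and "a \<le> u"
  shows "\<bar>measure \<mu> {..<a} - measure \<nu> {..<a}\<bar> \<le> e"
proof (rule tendsto_upperbound)
  show "((\<lambda>x. \<bar>cdf \<mu> x - cdf \<nu> x\<bar>) \<longlongrightarrow> \<bar>measure \<mu> {..<a} - measure \<nu> {..<a}\<bar>) (at_left a)"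
    by (intro tendsto_intros finite_borel_measure.cdf_at_left \<mu> \<nu>)
  show "\<forall>\<^sub>F x in at_left a. \<bar>cdf \<mu> x - cdf \<nu> x\<bar> \<le> e"
    using close \<open>a \<le> u\<close> by (auto simp: eventually_at_filter intro!: always_eventually)
qed simp

lemma cdf_discrepancy_down_set:
  assumes \<mu>: "finite_borel_measure \<mu>" and \<nu>: "finite_borel_measure \<nu>"
    and close: "\<And>x. x \<le> u \<Longrightarrow> \<bar>cdf \<mu> x - cdf \<nu> x\<bar> \<le> e"
    and D: "D \<subseteq> {..u}" and down: "\<And>x y. x \<in> D \<Longrightarrow> y \<le> x \<Longrightarrow> y \<in> D"
  shows "D \<in> sets borel" and "\<bar>measure \<mu> D - measure \<nu> D\<bar> \<le> e"
proof -
  have "D \<in> sets borel \<and> \<bar>measure \<mu> D - measure \<nu> D\<bar> \<le> e"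
  proof (cases "D = {}")
    case True
    have "0 \<le> \<bar>cdf \<mu> u - cdf \<nu> u\<bar>" by simp
    also have "\<dots> \<le> e" by (rule close) simp
    finally show ?thesis using True by simp
  next
    case False
    define a where "a = Sup D"
    have bdd: "bdd_above D" using D by (meson atMost_iff bdd_aboveI subsetD)
    have "a \<le> u" unfolding a_def using D by (intro cSup_least False) auto
    have le: "x \<le> a" if "x \<in> D" for x unfolding a_def using that bdd by (rule cSup_upper)
    have lt: "x \<in> D" if "x < a" for x
      using that down less_cSup_iff[OF False bdd] unfolding a_def by (meson less_imp_le)
    show ?thesis
    proof (cases "a \<in> D")
      case True
      then have "D = {..a}" using le lt by (auto simp: order_le_less)
      with close[OF \<open>a \<le> u\<close>] show ?thesis by (simp add: cdf_def)
    next
      case False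
      then have "D = {..<a}" using le lt by (auto simp: order_less_le)
      moreover have "\<bar>measure \<mu> {..<a} - measure \<nu> {..<a}\<bar> \<le> e"
        by (rule cdf_discrepancy_open_half_line[OF \<mu> \<nu> close \<open>a \<le> u\<close>])
      ultimately show ?thesis by simp
    qed
  qed
  then show "D \<in> sets borel" "\<bar>measure \<mu> D - measure \<nu> D\<bar> \<le> e" by blast+
qed

text \<open>
  An interval is the difference of two down-sets, and a proper down-set of the real line is a closed
  or an open half line; each of the two half lines contributes \<open>e\<close>.
\<close>

lemma cdf_discrepancy_interval:
  assumes \<mu>: "finite_borel_measure \<mu>" and \<nu>: "finite_borel_measure \<nu>"
    and close: "\<And>x. x \<le> u \<Longrightarrow> \<bar>cdf \<mu> x - cdf \<nu> x\<bar> \<le> e"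
    and I: "is_interval I" "I \<subseteq> {..u}"
  shows "\<bar>measure \<mu> I - measure \<nu> I\<bar> \<le> 2 * e"
proof -
  define B where "B = {x. \<exists>y\<in>I. x \<le> y}"
  define A where "A = B - I"
  have B: "B \<subseteq> {..u}" using I(2) unfolding B_def by force
  have downB: "y \<in> B" if "x \<in> B" "y \<le> x" for x y using that order_trans unfolding B_def by blast
  have downA: "y \<in> A" if xA: "x \<in> A" "y \<le> x" for x y
  proof -
    obtain z where z: "z \<in> I" "x \<le> z" using xA(1) unfolding A_def B_def by blast
    have "y \<notin> I" using I(1) z that unfolding is_interval_1 A_def by blast
    with downB that show ?thesis unfolding A_def by blast
  qed
  have A: "A \<subseteq> {..u}" using B unfolding A_def by blast
  have diff: "measure \<kappa> I = measure \<kappa> B - measure \<kappa> A" if "finite_borel_measure \<kappa>" for \<kappa>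
  proof -
    interpret finite_borel_measure \<kappa> by fact
    have "B \<in> sets borel" by (rule cdf_discrepancy_down_set(1)[OF \<mu> \<nu> close B downB])
    moreover have "A \<in> sets borel" by (rule cdf_discrepancy_down_set(1)[OF \<mu> \<nu> close A downA])
    ultimately have "B \<in> sets \<kappa>" "A \<in> sets \<kappa>" by auto
    moreover have "I = B - A" "A \<subseteq> B" unfolding A_def B_def by auto
    ultimately show ?thesis by (metis finite_measure_Diff)
  qed
  have "\<bar>measure \<mu> B - measure \<nu> B\<bar> \<le> e"
    by (rule cdf_discrepancy_down_set(2)[OF \<mu> \<nu> close B downB])
  moreover have "\<bar>measure \<mu> A - measure \<nu> A\<bar> \<le> e"
    by (rule cdf_discrepancy_down_set(2)[OF \<mu> \<nu> close A downA])
  ultimately show ?thesis unfolding diff[OF \<mu>] diff[OF \<nu>] by linarith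
qed

lemma set_integrable_of_levels:
  fixes h :: "real \<Rightarrow> real"
  assumes \<mu>: "finite_borel_measure \<mu>"
    and bnd: "\<And>x. x \<in> S \<Longrightarrow> 0 \<le> h x \<and> h x \<le> V" and "0 \<le> V"
    and lev: "\<And>c. {x\<in>S. c \<le> h x} \<in> sets borel"
  shows "set_integrable \<mu> S h"
proof -
  interpret finite_borel_measure \<mu> by fact
  have hm: "(\<lambda>x. indicator S x * h x) \<in> borel_measurable borel"
  proof (subst borel_measurable_iff_ge, intro allI)
    fix c
    have "{w \<in> space borel. c \<le> indicator S w * h w} = (if c \<le> 0 then UNIV else {x\<in>S. c \<le> h x})"
      using bnd by (auto simp: indicator_def split: if_splits) (meson order_trans)
    then show "{w \<in> space borel. c \<le> indicator S w * h w} \<in> sets borel"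
      using lev by auto
  qed
  have "integrable \<mu> (\<lambda>x. indicator S x * h x)"
  proof (rule integrable_const_bound[of _ V])
    show "AE x in \<mu>. norm (indicator S x * h x) \<le> V"
      using bnd \<open>0 \<le> V\<close> by (auto simp: indicator_def)
  qed (use hm measurable_cong_sets[OF M_is_borel refl] in auto)
  then show ?thesis by (simp add: set_integrable_def)
qed


text \<open>
  A layer-cake argument with finite sums: \<open>h\<close> is approximated from below, up to \<open>V / m\<close>, by the
  mean of the \<open>m\<close> scaled indicators of the sets \<open>{x \<in> S. j V / m \<le> h x}\<close>, and each of them
  contributes at most \<open>d\<close>.
\<close>

lemma integral_discrepancy_of_levels:
  fixes h :: "real \<Rightarrow> real"
  assumes \<mu>: "finite_borel_measure \<mu>" and \<nu>: "finite_borel_measure \<nu>"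
    and bnd: "\<And>x. x \<in> S \<Longrightarrow> 0 \<le> h x \<and> h x \<le> V" and "0 \<le> V"
    and lev: "\<And>c. {x\<in>S. c \<le> h x} \<in> sets borel"
    and close: "\<And>c. \<bar>measure \<mu> {x\<in>S. c \<le> h x} - measure \<nu> {x\<in>S. c \<le> h x}\<bar> \<le> d"
  shows "\<bar>(LINT x:S|\<mu>. h x) - (LINT x:S|\<nu>. h x)\<bar> \<le> V * d"
proof -
  define L where "L c = {x\<in>S. c \<le> h x}" for c
  define st where "st m x = (\<Sum>j=1..m. (V / m) * indicator (L (j * (V / m))) x)" for m :: nat and x
  have Lm: "L c \<in> sets borel" for c using lev by (simp add: L_def)
  have st_bound: "indicator S x * h x - V / m \<le> st m x \<and> st m x \<le> indicator S x * h x"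
    if "m \<ge> 1" for m :: nat and x
  proof (cases "x \<in> S \<and> 0 < V")
    case False
    have "st m x = 0" using False \<open>0 \<le> V\<close> by (auto simp: st_def L_def)
    moreover have "indicator S x * h x = 0" using False \<open>0 \<le> V\<close> bnd[of x] by (auto simp: indicator_def)
    moreover have "0 \<le> V / m" using \<open>0 \<le> V\<close> by simp
    ultimately show ?thesis by (metis diff_0 neg_le_0_iff_le order_refl)
  next
    case True
    define p where "p = nat \<lfloor>h x / (V / m)\<rfloor>"
    have pos: "0 < V / m" using True that by simp
    have q0: "0 \<le> h x / (V / m)" using bnd[of x] True by simp
    have p: "real p \<le> h x / (V / m)" "h x / (V / m) < real p + 1"
      using q0 by (auto simp: p_def)
    have pm: "p \<le> m"
    proof -
      have "real p \<le> h x / (V / m)" by (rule p)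
      also have "\<dots> \<le> V / (V / m)" using bnd[of x] True pos by (intro divide_right_mono) auto
      also have "\<dots> = m" using True by simp
      finally show ?thesis by simp
    qed
    have iff: "x \<in> L (j * (V / m)) \<longleftrightarrow> j \<le> p" for j :: nat
    proof -
      have "x \<in> L (j * (V / m)) \<longleftrightarrow> real j \<le> h x / (V / m)"
        using pos_le_divide_eq[OF pos, of "real j" "h x"] True by (metis (no_types, lifting) L_def mem_Collect_eq)
      also have "\<dots> \<longleftrightarrow> j \<le> p" using p by linarith
      finally show ?thesis .
    qed
    have "st m x = (\<Sum>j=1..m. (V / m) * of_bool (j \<le> p))"
      unfolding st_def by (intro sum.cong refl arg_cong2[where f="(*)"]) (subst indicator_def, subst iff, rule refl)
    also have "\<dots> = (\<Sum>j=1..p. V / m)"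
      using pm by (intro sum.mono_neutral_cong_right) auto
    also have "\<dots> = p * (V / m)" by simp
    finally have st_eq: "st m x = p * (V / m)" .
    have "p * (V / m) \<le> h x" "h x < (real p + 1) * (V / m)"
      using p unfolding pos_le_divide_eq[OF pos] pos_divide_less_eq[OF pos] by blast+
    then have "p * (V / m) \<le> h x" "h x < p * (V / m) + V / m"
      by (simp_all only: distrib_right mult_1)
    moreover have "indicator S x * h x = h x" using True by simp
    ultimately show ?thesis unfolding st_eq by linarith
  qed
  have key: "\<bar>(LINT x:S|\<mu>. h x) - (LINT x:S|\<nu>. h x)\<bar> \<le>
      V * d + (V / m) * (measure \<mu> UNIV + measure \<nu> UNIV)" if "m \<ge> 1" for m :: nat
  proof -
    have step: "integral\<^sup>L \<kappa> (st m) = (\<Sum>j=1..m. (V / m) * measure \<kappa> (L (j * (V / m)))) \<and>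
        \<bar>(LINT x:S|\<kappa>. h x) - integral\<^sup>L \<kappa> (st m)\<bar> \<le> (V / m) * measure \<kappa> UNIV"
      if "finite_borel_measure \<kappa>" for \<kappa>
    proof -
      interpret finite_borel_measure \<kappa> by fact
      note [measurable_cong] = M_is_borel
      note [measurable] = Lm
      have Ls: "L c \<in> sets \<kappa>" for c using Lm M_is_borel by auto
      have hi: "integrable \<kappa> (\<lambda>x. indicator S x * h x)"
        using set_integrable_of_levels[OF that bnd \<open>0 \<le> V\<close> lev] by (simp add: set_integrable_def)
      have si: "integrable \<kappa> (st m)"
        unfolding st_def by (auto intro!: Bochner_Integration.integrable_sum simp: Ls emeasure_eq_measure)
      have "integral\<^sup>L \<kappa> (st m) = (\<Sum>j=1..m. (V / m) * measure \<kappa> (L (j * (V / m))))"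
        unfolding st_def
        by (subst Bochner_Integration.integral_sum) (auto simp: Ls emeasure_eq_measure borel_UNIV)
      moreover have "\<bar>(LINT x:S|\<kappa>. h x) - integral\<^sup>L \<kappa> (st m)\<bar> \<le> (V / m) * measure \<kappa> UNIV"
      proof -
        have "\<bar>(LINT x:S|\<kappa>. h x) - integral\<^sup>L \<kappa> (st m)\<bar> = \<bar>\<integral>x. indicator S x * h x - st m x \<partial>\<kappa>\<bar>"
          using hi si by (simp add: set_lebesgue_integral_def)
        also have "\<dots> \<le> (\<integral>x. \<bar>indicator S x * h x - st m x\<bar> \<partial>\<kappa>)" by (rule integral_abs_bound)
        also have "\<dots> \<le> (\<integral>x. V / m \<partial>\<kappa>)"
          using hi si st_bound[OF \<open>m \<ge> 1\<close>]
          by (intro integral_mono integrable_abs Bochner_Integration.integrable_diff)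
            (auto simp: abs_le_iff algebra_simps)
        also have "\<dots> = (V / m) * measure \<kappa> UNIV" using borel_UNIV by simp
        finally show ?thesis .
      qed
      ultimately show ?thesis by blast
    qed
    have "\<bar>integral\<^sup>L \<mu> (st m) - integral\<^sup>L \<nu> (st m)\<bar> =
        \<bar>\<Sum>j=1..m. (V / m) * (measure \<mu> (L (j * (V / m))) - measure \<nu> (L (j * (V / m))))\<bar>"
      using step[OF \<mu>] step[OF \<nu>] by (simp add: sum_subtractf right_diff_distrib)
    also have "\<dots> \<le> (\<Sum>j=1..m. (V / m) * d)"
      using close \<open>0 \<le> V\<close> by (intro sum_abs[THEN order_trans] sum_mono)
        (auto simp: abs_mult L_def intro!: mult_left_mono divide_right_mono)
    also have "\<dots> = V * d" using \<open>m \<ge> 1\<close> by simp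
    finally show ?thesis using step[OF \<mu>] step[OF \<nu>] unfolding distrib_left by linarith
  qed
  have "(\<lambda>m. V * d + V * (measure \<mu> UNIV + measure \<nu> UNIV) * inverse (real m)) \<longlonglongrightarrow> V * d + V * (measure \<mu> UNIV + measure \<nu> UNIV) * 0"
    by (intro tendsto_intros LIMSEQ_inverse_real_of_nat lim_inverse_n)
  then have "\<bar>(LINT x:S|\<mu>. h x) - (LINT x:S|\<nu>. h x)\<bar> \<le>
      V * d + V * (measure \<mu> UNIV + measure \<nu> UNIV) * 0"
  proof (rule LIMSEQ_le_const)
    show "\<exists>N. \<forall>n\<ge>N. \<bar>(LINT x:S|\<mu>. h x) - (LINT x:S|\<nu>. h x)\<bar>
       \<le> V * d + V * (measure \<mu> UNIV + measure \<nu> UNIV) * inverse (real n)"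
      using key by (intro exI[of _ 1]) (auto simp: field_simps)
  qed
  then show ?thesis by simp
qed

lemma is_interval_superlevel:
  fixes h :: "real \<Rightarrow> real"
  assumes S: "is_interval S" and mono: "mono_on S h \<or> antimono_on S h"
  shows "is_interval {x\<in>S. c \<le> h x}"
proof -
  have "y \<in> {x\<in>S. c \<le> h x}" if "a \<in> {x\<in>S. c \<le> h x}" "b \<in> {x\<in>S. c \<le> h x}" "a \<le> y" "y \<le> b" for a b y
  proof -
    have yS: "y \<in> S" using S that unfolding is_interval_1 by blast
    have "h a \<le> h y \<or> h b \<le> h y"
      using mono that yS by (auto simp: monotone_on_def)
    then show ?thesis using that yS by auto
  qed
  then show ?thesis unfolding is_interval_1 by blast
qed

lemma set_integrable_monotone:
  fixes h :: "real \<Rightarrow> real"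
  assumes "finite_borel_measure \<mu>" "is_interval S"
    and "\<And>x. x \<in> S \<Longrightarrow> 0 \<le> h x \<and> h x \<le> V" and "0 \<le> V"
    and "mono_on S h \<or> antimono_on S h"
  shows "set_integrable \<mu> S h"
  using assms by (intro set_integrable_of_levels[of \<mu> S h V] real_interval_borel_measurable
      is_interval_superlevel) auto

text \<open>
  The superlevel sets of a monotone function are intervals. This takes the place of integration by
  parts, also at points where both \<open>h\<close> and the distribution functions jump.
\<close>

lemma integral_discrepancy_monotone:
  fixes h :: "real \<Rightarrow> real"
  assumes \<mu>: "finite_borel_measure \<mu>" and \<nu>: "finite_borel_measure \<nu>"
    and close: "\<And>x. x \<le> u \<Longrightarrow> \<bar>cdf \<mu> x - cdf \<nu> x\<bar> \<le> e"
    and S: "is_interval S" "S \<subseteq> {..u}"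
    and bnd: "\<And>x. x \<in> S \<Longrightarrow> 0 \<le> h x \<and> h x \<le> V" and "0 \<le> V"
    and mono: "mono_on S h \<or> antimono_on S h"
  shows "\<bar>(LINT x:S|\<mu>. h x) - (LINT x:S|\<nu>. h x)\<bar> \<le> V * (2 * e)"
proof -
  note lev = is_interval_superlevel[OF S(1) mono]
  show ?thesis
  proof (rule integral_discrepancy_of_levels[OF \<mu> \<nu> bnd \<open>0 \<le> V\<close>])
    show "{x\<in>S. c \<le> h x} \<in> sets borel" for c using lev by (rule real_interval_borel_measurable)
    show "\<bar>measure \<mu> {x\<in>S. c \<le> h x} - measure \<nu> {x\<in>S. c \<le> h x}\<bar> \<le> 2 * e" for c
      using S(2) by (intro cdf_discrepancy_interval[OF \<mu> \<nu> close lev]) auto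
  qed auto
qed

section \<open>Kernels of bounded variation\<close>

text \<open>
  The first component is the variation on \<open>{r<..x}\<close>; it grows by at least \<open>\<bar>k y - k x\<bar>\<close> between \<open>x\<close>
  and \<open>y\<close>, because every partition can be prolonged by these two points. A constant is added to make
  both components nonnegative.
\<close>

lemma bounded_variation_jordan_decomposition:
  fixes k :: "real \<Rightarrow> real"
  assumes bv: "bounded_variation_on {r<..<s} k" and "r < s"
  obtains v w V where "mono_on {r<..<s} v" "mono_on {r<..<s} w" "0 \<le> V"
    "\<And>x. x \<in> {r<..<s} \<Longrightarrow> 0 \<le> v x \<and> v x \<le> V \<and> 0 \<le> w x \<and> w x \<le> V \<and> k x = v x - w x"
proof -
  let ?var = "\<lambda>m (p :: nat \<Rightarrow> real). \<Sum>i<m. \<bar>k (p (Suc i)) - k (p i)\<bar>"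
  obtain C where C: "\<And>m p. p ` {..m} \<subseteq> {r<..<s} \<Longrightarrow> mono_on {..m} p \<Longrightarrow> ?var m p \<le> C"
    using bv unfolding bounded_variation_on_def by blast
  define W where "W x = {?var m p | m p. p ` {..m} \<subseteq> {r<..<s} \<inter> {..x} \<and> mono_on {..m} p}" for x
  define v0 where "v0 x = Sup (W x)" for x
  have W0: "0 \<in> W x" if "x \<in> {r<..<s}" for x
    unfolding W_def using that
    by (intro CollectI exI[of _ 0] exI[of _ "\<lambda>_. x"]) (auto simp: monotone_on_def)
  have Wle: "z \<le> C" if "z \<in> W x" for z x
    using that C unfolding W_def by auto
  have bdd: "bdd_above (W x)" for x using Wle by (meson bdd_aboveI)
  have v0: "0 \<le> v0 x" "v0 x \<le> C" if "x \<in> {r<..<s}" for x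
    unfolding v0_def using W0[OF that] Wle by (auto intro: cSup_upper[OF _ bdd] intro!: cSup_least)
  have incr: "v0 x + \<bar>k y - k x\<bar> \<le> v0 y" if xy: "x \<in> {r<..<s}" "y \<in> {r<..<s}" "x \<le> y" for x y
  proof -
    have "z \<le> v0 y - \<bar>k y - k x\<bar>" if z: "z \<in> W x" for z
    proof -
      obtain m p where mp: "z = ?var m p" "p ` {..m} \<subseteq> {r<..<s} \<inter> {..x}" "mono_on {..m} p"
        using z unfolding W_def by blast
      \<comment> \<open>The partition prolonged by the points \<open>x\<close> and \<open>y\<close>.\<close>
      define q where "q i = (if i \<le> m then p i else if i = Suc m then x else y)" for i
      have "?var (Suc (Suc m)) q = (\<Sum>i<m. \<bar>k (p (Suc i)) - k (p i)\<bar>) + \<bar>k x - k (p m)\<bar> + \<bar>k y - k x\<bar>"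
        by (simp add: q_def)
      moreover have "?var (Suc (Suc m)) q \<in> W y"
      proof -
        have "q ` {..Suc (Suc m)} \<subseteq> {r<..<s} \<inter> {..y}"
          using mp(2) xy by (auto simp: q_def image_subset_iff intro: order_trans[of _ x y])
        moreover have "mono_on {..Suc (Suc m)} q"
        proof (rule monotone_onI)
          fix i j assume "i \<in> {..Suc (Suc m)}" "j \<in> {..Suc (Suc m)}" "i \<le> j"
          then show "q i \<le> q j"
            using mp(2,3) xy
            by (cases "j \<le> m"; cases "i \<le> m") (auto simp: q_def image_subset_iff monotone_on_def intro: order_trans)
        qed
        ultimately show ?thesis unfolding W_def by blast
      qed
      then have "?var (Suc (Suc m)) q \<le> v0 y" unfolding v0_def by (rule cSup_upper[OF _ bdd])
      ultimately show ?thesis using mp(1) by linarith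
    qed
    then have "v0 x \<le> v0 y - \<bar>k y - k x\<bar>"
      unfolding v0_def[of x] using W0[OF xy(1)] by (intro cSup_least) auto
    then show ?thesis by simp
  qed
  define c where "c = (r + s) / 2"
  have c: "c \<in> {r<..<s}" using \<open>r < s\<close> by (simp add: c_def)
  define K where "K = \<bar>k c\<bar> + C"
  have kK: "\<bar>k x\<bar> \<le> K" if "x \<in> {r<..<s}" for x
  proof -
    have "\<bar>k x - k c\<bar> \<le> C"
      using incr[OF that c] incr[OF c that] v0[OF that] v0[OF c] by linarith
    then show ?thesis unfolding K_def by linarith
  qed
  have "0 \<le> C" using v0[OF c] by simp
  show thesis
  proof
    show "mono_on {r<..<s} (\<lambda>x. v0 x + K)" "mono_on {r<..<s} (\<lambda>x. v0 x + K - k x)"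
      using incr by (auto intro!: monotone_onI) (smt (verit) greaterThanLessThan_iff)+
    show "0 \<le> C + 2 * K" using \<open>0 \<le> C\<close> by (simp add: K_def)
    fix x assume x: "x \<in> {r<..<s}"
    show "0 \<le> v0 x + K \<and> v0 x + K \<le> C + 2 * K \<and> 0 \<le> v0 x + K - k x \<and> v0 x + K - k x \<le> C + 2 * K \<and>
         k x = v0 x + K - (v0 x + K - k x)"
      using v0[OF x] kK[OF x] \<open>0 \<le> C\<close> by (auto simp: abs_le_iff)
  qed
qed

lemma bounded_variation_imp_bounded:
  fixes k :: "real \<Rightarrow> real"
  assumes "bounded_variation_on {r<..<s} k" "r < s" and supp: "\<And>x. x \<notin> {r<..<s} \<Longrightarrow> k x = 0"
  shows "\<exists>K. \<forall>x. \<bar>k x\<bar> \<le> K"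
proof -
  obtain v w V where vw: "0 \<le> V"
    "\<And>x. x \<in> {r<..<s} \<Longrightarrow> 0 \<le> v x \<and> v x \<le> V \<and> 0 \<le> w x \<and> w x \<le> V \<and> k x = v x - w x"
    using bounded_variation_jordan_decomposition[OF assms(1,2)] by metis
  have "\<bar>k x\<bar> \<le> V" for x
    using vw(1) vw(2)[of x] supp[of x] by (cases "x \<in> {r<..<s}") auto
  then show ?thesis by blast
qed

text \<open>
  The constant depends only on the kernel: after rescaling, the two monotone components keep their
  bounds for every bandwidth \<open>b\<close>. The set \<open>A\<close> carries the range of integration of the smoothed
  estimators; cutting the support of the kernel with it leaves an interval.
\<close>

lemma kernel_integral_discrepancy:
  fixes k :: "real \<Rightarrow> real"
  assumes bv: "bounded_variation_on {r<..<s} k" and "r < s"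
    and supp: "\<And>x. x \<notin> {r<..<s} \<Longrightarrow> k x = 0"
  shows "\<exists>C\<ge>0. \<forall>\<mu> \<nu> (u :: real) e (A :: real set) b t.
      finite_borel_measure \<mu> \<longrightarrow> finite_borel_measure \<nu> \<longrightarrow>
      (\<forall>x\<le>u. \<bar>cdf \<mu> x - cdf \<nu> x\<bar> \<le> e) \<longrightarrow> is_interval A \<longrightarrow> 0 < b \<longrightarrow> t - r * b \<le> u \<longrightarrow>
      \<bar>(LINT x:A|\<mu>. k ((t - x) / b)) - (LINT x:A|\<nu>. k ((t - x) / b))\<bar> \<le> C * e"
proof -
  obtain v w V where vw: "mono_on {r<..<s} v" "mono_on {r<..<s} w" "0 \<le> V"
    "\<And>x. x \<in> {r<..<s} \<Longrightarrow> 0 \<le> v x \<and> v x \<le> V \<and> 0 \<le> w x \<and> w x \<le> V \<and> k x = v x - w x"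
    using bounded_variation_jordan_decomposition[OF bv \<open>r < s\<close>] by metis
  show ?thesis
  proof (intro exI[of _ "4 * V"] conjI allI impI)
    show "0 \<le> 4 * V" using \<open>0 \<le> V\<close> by simp
    fix \<mu> \<nu> :: "real measure" and u e b t :: real and A :: "real set"
    assume \<mu>: "finite_borel_measure \<mu>" and \<nu>: "finite_borel_measure \<nu>"
      and "\<forall>x\<le>u. \<bar>cdf \<mu> x - cdf \<nu> x\<bar> \<le> e"
      and A: "is_interval A" and b: "0 < b" and t: "t - r * b \<le> u"
    then have close: "\<And>x. x \<le> u \<Longrightarrow> \<bar>cdf \<mu> x - cdf \<nu> x\<bar> \<le> e" by blast
    define S where "S = A \<inter> {t - s * b<..<t - r * b}"
    have S: "is_interval S" "S \<subseteq> {..u}"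
      using A t by (auto simp: S_def intro!: is_interval_Int)
    have inS: "(t - x) / b \<in> {r<..<s} \<longleftrightarrow> x \<in> {t - s * b<..<t - r * b}" for x
      using b by (auto simp: field_simps)
    have anti: "antimono_on S (\<lambda>x. h ((t - x) / b))" if "mono_on {r<..<s} h" for h
      using b inS by (intro monotone_onI monotone_onD[OF that]) (auto simp: S_def divide_right_mono)
    have red: "(LINT x:A|\<kappa>. k ((t - x) / b)) =
        (LINT x:S|\<kappa>. v ((t - x) / b)) - (LINT x:S|\<kappa>. w ((t - x) / b))"
      if \<kappa>: "finite_borel_measure \<kappa>" for \<kappa>
    proof -
      have "(LINT x:A|\<kappa>. k ((t - x) / b)) = (LINT x:S|\<kappa>. v ((t - x) / b) - w ((t - x) / b))"
        unfolding set_lebesgue_integral_def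
      proof (intro Bochner_Integration.integral_cong refl)
        fix x
        show "indicator A x *\<^sub>R k ((t - x) / b) = indicator S x *\<^sub>R (v ((t - x) / b) - w ((t - x) / b))"
          using supp[of "(t - x) / b"] vw(4)[of "(t - x) / b"] inS[of x]
          by (cases "x \<in> {t - s * b<..<t - r * b}") (auto simp: indicator_def S_def)
      qed
      also have "\<dots> = (LINT x:S|\<kappa>. v ((t - x) / b)) - (LINT x:S|\<kappa>. w ((t - x) / b))"
        using vw anti inS
        by (intro set_integral_diff set_integrable_monotone[OF \<kappa> S(1) _ \<open>0 \<le> V\<close>] disjI2 anti)
          (auto simp: S_def)
      finally show ?thesis .
    qed
    have "\<bar>(LINT x:S|\<mu>. h ((t - x) / b)) - (LINT x:S|\<nu>. h ((t - x) / b))\<bar> \<le> V * (2 * e)"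
      if "mono_on {r<..<s} h" "\<And>x. x \<in> {r<..<s} \<Longrightarrow> 0 \<le> h x \<and> h x \<le> V" for h
      using that inS by (intro integral_discrepancy_monotone[OF \<mu> \<nu> close S _ \<open>0 \<le> V\<close>] disjI2 anti)
        (auto simp: S_def)
    from this[OF vw(1)] this[OF vw(2)] vw(4)
    show "\<bar>(LINT x:A|\<mu>. k ((t - x) / b)) - (LINT x:A|\<nu>. k ((t - x) / b))\<bar> \<le> 4 * V * e"
      unfolding red[OF \<mu>] red[OF \<nu>] by (simp add: abs_le_iff)
  qed
qed

section \<open>Distribution functions and the cumulative hazard\<close>

lemma measure_atLeast_atomless:
  assumes "real_distribution R" "\<And>x. measure R {x} = 0"
  shows "measure R {t..} = 1 - cdf R t"
proof -
  interpret R: real_distribution R by fact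
  have "measure R (UNIV - {..<t}) = 1 - measure R {..<t}"
    using R.prob_compl[of "{..<t}"] by simp
  moreover have "UNIV - {..<t} = {t..}" by auto
  moreover have "measure R {..t} = measure R {..<t} + measure R {t}"
    unfolding ivl_disj_un(2)[symmetric] by (subst R.finite_measure_Union) auto
  ultimately show ?thesis by (simp add: cdf_def assms(2))
qed

text \<open>
  The law \<open>\<mu>\<close> is the image of the uniform law on the unit interval under the quantile function,
  and continuity makes the quantile function a right inverse of the distribution function. Hence the
  integral becomes that of \<open>1 / (1 - w)\<close> over \<open>{0..cdf \<mu> x}\<close>.
\<close>

lemma cumulative_hazard_continuous_cdf:
  assumes \<mu>: "real_distribution \<mu>" and cts: "\<And>x. isCont (cdf \<mu>) x" and x: "cdf \<mu> x < 1"
  shows "(LINT y:{..x}|\<mu>. 1 / (1 - cdf \<mu> y)) = - ln (1 - cdf \<mu> x)"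
proof -
  interpret cdf_distribution \<mu> using \<mu> by (simp add: cdf_distribution_def)
  let ?\<Omega> = "restrict_space lborel {0<..<1::real}"
  have CI: "C (I w) = w" if w: "0 < w" "w < 1" for w
  proof (rule antisym)
    show "w \<le> C (I w)" using pseudoinverse[OF w, of "I w"] by simp
    have "(C \<longlongrightarrow> C (I w)) (at_left (I w))"
      using continuous_at_imp_continuous_at_within[OF cts[of "I w"], of "{..<I w}"]
      by (simp only: continuous_within)
    moreover have "\<forall>\<^sub>F y in at_left (I w). C y \<le> w"
      unfolding eventually_at_filter
    proof (intro always_eventually allI impI)
      fix y assume "y \<in> {..<I w}"
      then have "\<not> w \<le> C y" using pseudoinverse[OF w, of y] by simp
      then show "C y \<le> w" by simp
    qed
    ultimately show "C (I w) \<le> w" by (rule tendsto_upperbound) simp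
  qed
  define h where "h y = indicator {..x} y * (1 / (1 - C y))" for y
  have hm: "h \<in> borel_measurable borel" unfolding h_def by measurable
  have "(LINT y:{..x}|\<mu>. 1 / (1 - C y)) = integral\<^sup>L (distr ?\<Omega> borel I) h"
    unfolding distr_I_eq_M set_lebesgue_integral_def
    by (intro Bochner_Integration.integral_cong) (simp_all add: h_def)
  also have "\<dots> = (\<integral>w. h (I w) \<partial>?\<Omega>)"
    using hm by (intro integral_distr) (auto simp: measurable_lborel2 cong: measurable_cong_sets)
  also have "\<dots> = (LINT w:{0<..<1}|lborel. h (I w))"
    by (subst integral_restrict_space) (simp_all add: set_lebesgue_integral_def)
  also have "\<dots> = (\<integral>w. indicator {0..C x} w *\<^sub>R (1 / (1 - w)) \<partial>lborel)"
    unfolding set_lebesgue_integral_def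
  proof (rule integral_cong_AE)
    have "(\<lambda>w. h (I w)) \<in> borel_measurable ?\<Omega>"
      using hm by (rule measurable_compose[rotated]) (auto cong: measurable_cong_sets)
    then show "(\<lambda>w. indicator {0<..<1} w *\<^sub>R h (I w)) \<in> borel_measurable lborel"
      by (subst (asm) borel_measurable_restrict_space_iff) auto
    show "AE w in lborel. indicator {0<..<1} w *\<^sub>R h (I w) = indicator {0..C x} w *\<^sub>R (1 / (1 - w))"
      using AE_lborel_singleton[of 0]
    proof eventually_elim
      case (elim w)
      have "C x < 1" "0 \<le> C x" using x cdf_nonneg by auto
      show ?case
      proof (cases "0 < w \<and> w < 1")
        case True
        then show ?thesis using CI[of w] pseudoinverse[of w x] by (simp add: indicator_def h_def)
      next
        case False
        then have "w \<notin> {0<..<1}" "w \<notin> {0..C x}" using elim \<open>C x < 1\<close> by auto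
        then show ?thesis by simp
      qed
    qed
  qed auto
  also have "\<dots> = - ln (1 - C x) - - ln (1 - 0)"
  proof (rule integral_FTC_atLeastAtMost)
    show "0 \<le> C x" by (rule cdf_nonneg)
    show "continuous_on {0..C x} (\<lambda>w. 1 / (1 - w))"
      using x by (intro continuous_intros) auto
    fix w assume "0 \<le> w" "w \<le> C x"
    then have "((\<lambda>w. - ln (1 - w)) has_real_derivative 1 / (1 - w)) (at w within {0..C x})"
      using x by (auto intro!: derivative_eq_intros simp: divide_simps)
    then show "((\<lambda>w. - ln (1 - w)) has_vector_derivative 1 / (1 - w)) (at w within {0..C x})"
      by (simp only: has_real_derivative_iff_has_vector_derivative)
  qed
  finally show ?thesis by simp
qed

lemma interval_measure_cdf:
  assumes "finite_borel_measure \<mu>"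
  shows "interval_measure (cdf \<mu>) = \<mu>"
proof (rule cdf_unique')
  interpret finite_borel_measure \<mu> by fact
  show "finite_borel_measure (interval_measure (cdf \<mu>))"
    by (rule finite_borel_measure_interval_measure[OF cdf_nondecreasing cdf_is_right_cont
          cdf_lim_at_bot cdf_lim_at_top]) auto
  show "cdf (interval_measure (cdf \<mu>)) = cdf \<mu>"
    by (intro cdf_interval_measure cdf_nondecreasing cdf_is_right_cont cdf_lim_at_bot)
qed fact

section \<open>The Kaplan-Meier estimator as a functional of the data\<close>

text \<open>
  For \<open>J\<close> the set of event times and \<open>q\<close> the factors of the product-limit estimator this says that
  the Kaplan-Meier estimator is the distribution function of a measure, possibly of total mass less
  than 1.
\<close>

lemma finite_borel_measure_of_finite_product:
  fixes q :: "real \<Rightarrow> real"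
  assumes J: "finite J" and q: "\<And>t. t \<in> J \<Longrightarrow> 0 \<le> q t \<and> q t \<le> 1"
  defines "D \<equiv> \<lambda>x. 1 - (\<Prod>t | t \<in> J \<and> t \<le> x. q t)"
  shows "finite_borel_measure (interval_measure D)" and "cdf (interval_measure D) = D"
proof -
  have mono: "D x \<le> D y" if "x \<le> y" for x y
  proof -
    have "(\<Prod>t | t \<in> J \<and> t \<le> y. q t) = (\<Prod>t | t \<in> J \<and> t \<le> x. q t) * (\<Prod>t | t \<in> J \<and> x < t \<and> t \<le> y. q t)"
      using J that by (subst prod.union_disjoint[symmetric]) (auto intro!: prod.cong)
    also have "\<dots> \<le> (\<Prod>t | t \<in> J \<and> t \<le> x. q t) * 1"
      using q by (intro mult_left_mono prod_le_1 prod_nonneg) auto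
    finally show ?thesis by (simp add: D_def)
  qed
  have cont: "continuous (at_right a) D" for a
  proof -
    have "\<forall>\<^sub>F x in at_right a. \<forall>t\<in>J. a < t \<longrightarrow> x < t"
      using J by (intro eventually_ball_finite) (auto simp: eventually_at_right_field)
    moreover have "\<forall>\<^sub>F x in at_right a. a < x" by (simp add: eventually_at_filter)
    ultimately have "\<forall>\<^sub>F x in at_right a. D a = D x"
    proof eventually_elim
      case (elim x)
      then have "{t. t \<in> J \<and> t \<le> a} = {t. t \<in> J \<and> t \<le> x}"
        by (auto simp: not_le[symmetric])
      then show ?case by (simp add: D_def)
    qed
    then show ?thesis unfolding continuous_within
      by (rule Lim_transform_eventually[OF tendsto_const])
  qed
  have "\<forall>\<^sub>F x in at_bot. \<forall>t\<in>J. x < t"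
    using J by (intro eventually_ball_finite) (auto intro: eventually_gt_at_bot)
  then have "\<forall>\<^sub>F x in at_bot. 0 = D x"
  proof eventually_elim
    case (elim x)
    then have "{t. t \<in> J \<and> t \<le> x} = {}" by force
    then show ?case by (simp only: D_def) simp
  qed
  then have bot: "(D \<longlongrightarrow> 0) at_bot" by (rule Lim_transform_eventually[OF tendsto_const])
  have "\<forall>\<^sub>F x in at_top. \<forall>t\<in>J. t \<le> x"
    using J by (intro eventually_ball_finite) (auto intro: eventually_ge_at_top)
  then have "\<forall>\<^sub>F x in at_top. 1 - prod q J = D x"
  proof eventually_elim
    case (elim x)
    then have "{t. t \<in> J \<and> t \<le> x} = J" by auto
    then show ?case by (simp only: D_def)
  qed
  then have top: "(D \<longlongrightarrow> 1 - prod q J) at_top" by (rule Lim_transform_eventually[OF tendsto_const])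
  have "0 \<le> 1 - prod q J" using q by (simp add: prod_le_1)
  then show "finite_borel_measure (interval_measure D)"
    by (intro finite_borel_measure_interval_measure[OF mono cont bot top])
  show "cdf (interval_measure D) = D"
    by (intro cdf_interval_measure mono cont bot)
qed

text \<open>
  The measure with distribution function \<open>sub_empirical\<close>, written as an image of a weighted point
  measure so that its integrals are finite sums. On uncensored indices the observed time is \<open>T i\<close>.
\<close>

definition event_measure :: "(nat \<Rightarrow> 'a \<Rightarrow> real) \<Rightarrow> (nat \<Rightarrow> 'a \<Rightarrow> real) \<Rightarrow> nat \<Rightarrow> 'a \<Rightarrow> real measure" where
  "event_measure T Y n \<omega> =
     distr (point_measure {1..n} (\<lambda>i. ennreal (of_bool (T i \<omega> \<le> Y i \<omega>) / n))) borel (\<lambda>i. T i \<omega>)"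

lemma integral_event_measure:
  fixes h :: "real \<Rightarrow> real"
  assumes "h \<in> borel_measurable borel"
  shows "integral\<^sup>L (event_measure T Y n \<omega>) h = (\<Sum>i=1..n. of_bool (T i \<omega> \<le> Y i \<omega>) * h (T i \<omega>)) / n"
  unfolding event_measure_def using assms
  by (subst integral_distr) (auto simp: lebesgue_integral_point_measure_finite sum_divide_distrib intro!: sum.cong
      simp del: sum_of_bool_mult_eq)

lemma finite_borel_measure_event_measure: "finite_borel_measure (event_measure T Y n \<omega>)"
proof -
  have "finite_measure (event_measure T Y n \<omega>)"
    unfolding event_measure_def
    by (intro finite_measure.finite_measure_distr finite_measureI)
      (auto simp: emeasure_point_measure_finite space_point_measure)
  then show ?thesis
    by (simp add: finite_borel_measure_def finite_borel_measure_axioms_def event_measure_def)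
qed

lemma measure_event_measure:
  assumes "A \<in> sets borel"
  shows "measure (event_measure T Y n \<omega>) A = (\<Sum>i=1..n. of_bool (T i \<omega> \<in> A \<and> T i \<omega> \<le> Y i \<omega>)) / n"
proof -
  interpret finite_borel_measure "event_measure T Y n \<omega>" by (rule finite_borel_measure_event_measure)
  have "measure (event_measure T Y n \<omega>) A = (\<integral>x. indicator A x \<partial>event_measure T Y n \<omega>)"
    using assms by (simp add: borel_UNIV)
  also have "\<dots> = (\<Sum>i=1..n. of_bool (T i \<omega> \<le> Y i \<omega>) * indicator A (T i \<omega>)) / n"
    using assms by (intro integral_event_measure) auto
  also have "\<dots> = (\<Sum>i=1..n. of_bool (T i \<omega> \<in> A \<and> T i \<omega> \<le> Y i \<omega>)) / n"
    by (intro arg_cong2[where f="(/)"] sum.cong) (auto simp: indicator_def)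
  finally show ?thesis .
qed

lemma uncensored_event_iff:
  "obs_time T Y i \<omega> \<le> t \<and> cens_ind T Y i \<omega> = 1 \<longleftrightarrow> T i \<omega> \<le> t \<and> T i \<omega> \<le> Y i \<omega>"
  by (auto simp: obs_time_def cens_ind_def min_def)

lemma cdf_event_measure: "cdf (event_measure T Y n \<omega>) = sub_empirical T Y n \<omega>"
  unfolding cdf_def sub_empirical_def uncensored_event_iff
  by (rule ext, subst measure_event_measure) auto

lemma interval_measure_sub_empirical:
  "interval_measure (sub_empirical T Y n \<omega>) = event_measure T Y n \<omega>"
  using interval_measure_cdf[OF finite_borel_measure_event_measure, of T Y n \<omega>]
  by (simp add: cdf_event_measure)

text \<open>
  The left limit in the definition is the measure of an open half line.
\<close>

lemma jump_events_eq:
  "jump_events T Y n \<omega> t = (\<Sum>i=1..n. of_bool (T i \<omega> = t \<and> T i \<omega> \<le> Y i \<omega>))"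
proof (cases "n = 0")
  case True
  then have "num_events T Y n \<omega> = (\<lambda>_. 0)" by (auto simp: num_events_def)
  then have "Lim (at_left t) (num_events T Y n \<omega>) = 0" by (simp add: tendsto_Lim)
  then show ?thesis using True by (simp add: jump_events_def num_events_def)
next
  case False
  let ?E = "event_measure T Y n \<omega>"
  interpret finite_borel_measure ?E by (rule finite_borel_measure_event_measure)
  have N: "num_events T Y n \<omega> = (\<lambda>t. n * cdf ?E t)"
    using False by (simp add: fun_eq_iff cdf_event_measure num_events_def sub_empirical_def)
  have "((\<lambda>t. n * cdf ?E t) \<longlongrightarrow> n * measure ?E {..<t}) (at_left t)"
    by (intro tendsto_intros cdf_at_left)
  then have L: "Lim (at_left t) (num_events T Y n \<omega>) = n * measure ?E {..<t}"
    unfolding N by (intro tendsto_Lim) auto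
  have "measure ?E {..t} = measure ?E {..<t} + measure ?E {t}"
    unfolding ivl_disj_un(2)[symmetric] by (subst finite_measure_Union) auto
  then have "jump_events T Y n \<omega> t = n * measure ?E {t}"
    unfolding jump_events_def L by (simp add: N cdf_def algebra_simps)
  then show ?thesis using False by (simp add: measure_event_measure)
qed

lemma jump_events_nonneg: "0 \<le> jump_events T Y n \<omega> t"
  by (simp add: jump_events_eq sum_nonneg)

lemma finite_jumps: "finite {t. 0 < jump_events T Y n \<omega> t}"
proof (rule finite_subset)
  show "{t. 0 < jump_events T Y n \<omega> t} \<subseteq> (\<lambda>i. T i \<omega>) ` {1..n}"
  proof
    fix t assume "t \<in> {t. 0 < jump_events T Y n \<omega> t}"
    then have "(\<Sum>i=1..n. of_bool (T i \<omega> = t \<and> T i \<omega> \<le> Y i \<omega>) :: real) \<noteq> 0"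
      by (simp only: jump_events_eq mem_Collect_eq less_irrefl)
    then obtain i where "i \<in> {1..n}" "(of_bool (T i \<omega> = t \<and> T i \<omega> \<le> Y i \<omega>) :: real) \<noteq> 0"
      by (rule sum.not_neutral_contains_not_neutral)
    then show "t \<in> (\<lambda>i. T i \<omega>) ` {1..n}" by auto
  qed
qed simp

lemma jump_events_le_at_risk: "jump_events T Y n \<omega> t \<le> num_at_risk T Y n \<omega> t"
proof -
  have eq: "num_at_risk T Y n \<omega> t = (\<Sum>i=1..n. of_bool (t \<le> obs_time T Y i \<omega>) :: real)"
    by (simp add: num_at_risk_def sum_of_bool_eq Int_def Collect_conj_eq[symmetric])
  show ?thesis
    unfolding jump_events_eq eq by (intro sum_mono) (auto simp: obs_time_def)
qed

lemma
  shows finite_borel_measure_kaplan_meier: "finite_borel_measure (interval_measure (kaplan_meier T Y n \<omega>))"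
    and cdf_kaplan_meier: "cdf (interval_measure (kaplan_meier T Y n \<omega>)) = kaplan_meier T Y n \<omega>"
proof -
  let ?J = "{t. 0 < jump_events T Y n \<omega> t}"
  let ?q = "\<lambda>t. 1 - jump_events T Y n \<omega> t / num_at_risk T Y n \<omega> t"
  have eq: "kaplan_meier T Y n \<omega> = (\<lambda>x. 1 - (\<Prod>t | t \<in> ?J \<and> t \<le> x. ?q t))"
    unfolding kaplan_meier_def by (auto simp: conj_commute)
  have q: "0 \<le> ?q t \<and> ?q t \<le> 1" for t
    using jump_events_nonneg[of T Y n \<omega> t] jump_events_le_at_risk[of T Y n \<omega> t]
    by (cases "num_at_risk T Y n \<omega> t = 0") (auto simp: divide_le_eq_1)
  show "finite_borel_measure (interval_measure (kaplan_meier T Y n \<omega>))"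
    "cdf (interval_measure (kaplan_meier T Y n \<omega>)) = kaplan_meier T Y n \<omega>"
    unfolding eq by (rule finite_borel_measure_of_finite_product[OF finite_jumps q])+
qed

lemma sum_jumps_eq_integral:
  fixes \<phi> :: "real \<Rightarrow> real"
  assumes "set_integrable (event_measure T Y n \<omega>) {..x} \<phi>"
  shows "(LINT y:{..x}|event_measure T Y n \<omega>. \<phi> y) =
    (\<Sum>t | t \<le> x \<and> 0 < jump_events T Y n \<omega> t. (jump_events T Y n \<omega> t / n) * \<phi> t)"
proof -
  let ?J = "{t. t \<le> x \<and> 0 < jump_events T Y n \<omega> t}"
  let ?S = "{i\<in>{1..n}. T i \<omega> \<le> Y i \<omega> \<and> T i \<omega> \<le> x}"
  have m: "(\<lambda>y. indicator {..x} y *\<^sub>R \<phi> y) \<in> borel_measurable borel"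
    using borel_measurable_integrable[OF assms[unfolded set_integrable_def]]
    by (simp add: event_measure_def)
  have finJ: "finite ?J" using finite_jumps[of T Y n \<omega>] by (rule finite_subset[rotated]) auto
  have "(LINT y:{..x}|event_measure T Y n \<omega>. \<phi> y) =
      (\<Sum>i=1..n. of_bool (T i \<omega> \<le> Y i \<omega>) * (indicator {..x} (T i \<omega>) *\<^sub>R \<phi> (T i \<omega>))) / n"
    unfolding set_lebesgue_integral_def using m by (rule integral_event_measure)
  also have "(\<Sum>i=1..n. of_bool (T i \<omega> \<le> Y i \<omega>) * (indicator {..x} (T i \<omega>) *\<^sub>R \<phi> (T i \<omega>))) =
      (\<Sum>i\<in>?S. \<phi> (T i \<omega>))"
    by (intro sum.mono_neutral_cong_right) (auto simp: indicator_def)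
  also have "\<dots> = (\<Sum>t\<in>?J. \<Sum>i | i \<in> ?S \<and> T i \<omega> = t. \<phi> (T i \<omega>))"
  proof (rule sum.group[symmetric])
    show "(\<lambda>i. T i \<omega>) ` ?S \<subseteq> ?J"
    proof safe
      fix i assume i: "i \<in> {1..n}" "T i \<omega> \<le> Y i \<omega>" "T i \<omega> \<le> x"
      have "0 < (\<Sum>j=1..n. of_bool (T j \<omega> = T i \<omega> \<and> T j \<omega> \<le> Y j \<omega>) :: real)"
        using i by (intro sum_pos2[of _ i]) auto
      then show "0 < jump_events T Y n \<omega> (T i \<omega>)" by (simp add: jump_events_eq)
    qed
  qed (use finJ in auto)
  also have "\<dots> = (\<Sum>t\<in>?J. jump_events T Y n \<omega> t * \<phi> t)"
  proof (rule sum.cong[OF refl])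
    fix t assume t: "t \<in> ?J"
    have "(\<Sum>i | i \<in> ?S \<and> T i \<omega> = t. \<phi> (T i \<omega>)) = (\<Sum>i | i \<in> ?S \<and> T i \<omega> = t. 1) * \<phi> t"
      unfolding sum_distrib_right by (intro sum.cong) auto
    also have "(\<Sum>i | i \<in> ?S \<and> T i \<omega> = t. 1) = jump_events T Y n \<omega> t"
      unfolding jump_events_eq using t by (intro sum.mono_neutral_cong_left) auto
    finally show "(\<Sum>i | i \<in> ?S \<and> T i \<omega> = t. \<phi> (T i \<omega>)) = jump_events T Y n \<omega> t * \<phi> t" .
  qed
  finally show ?thesis by (simp add: sum_divide_distrib)
qed

lemma abs_diff_le_abs_ln_diff:
  fixes p s :: real
  assumes "0 < p" "p \<le> 1" "0 < s" "s \<le> 1"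
  shows "\<bar>p - s\<bar> \<le> \<bar>ln p - ln s\<bar>"
proof -
  have *: "q - r \<le> ln q - ln r" if "0 < r" "r \<le> q" "q \<le> 1" for q r :: real
  proof -
    have "q - r = q * (1 - r / q)" using that by (simp add: right_diff_distrib)
    also have "\<dots> \<le> 1 * (1 - r / q)" using that by (intro mult_right_mono) auto
    \<comment> \<open>This is \<open>ln z \<le> z - 1\<close> at \<open>z = r / q\<close>.\<close>
    also have "\<dots> \<le> - ln (r / q)" using that ln_le_minus_one[of "r / q"] by simp
    also have "\<dots> = ln q - ln r" using that by (simp add: ln_div)
    finally show ?thesis .
  qed
  show ?thesis using *[of s p] *[of p s] assms by (cases "s \<le> p") auto
qed

text \<open>
  Write \<open>a t\<close> for the proportion of events at \<open>t\<close>, \<open>R t\<close> for the proportion at risk and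
  \<open>d t = a t / R t\<close>. The logarithm of the estimator is compared with \<open>ln (S x)\<close> in three steps:
  \<open>ln (1 - d t)\<close> is replaced by \<open>- d t\<close>, at the cost of the squares of the jumps; \<open>R\<close> is replaced
  by its limit \<open>B\<close>; and the measure of events is replaced by \<open>\<nu>\<close>. The bounds on \<open>B\<close> and \<open>e\<close> keep
  \<open>R\<close> above \<open>c / 2\<close> and \<open>d\<close> below \<open>1 / 2\<close>.
\<close>

lemma kaplan_meier_discrepancy:
  fixes B S :: "real \<Rightarrow> real" and c e u :: real
  assumes n: "n \<ge> 1" and \<nu>: "finite_borel_measure \<nu>" and atomless: "\<And>t. measure \<nu> {t} = 0"
    and close: "\<And>t. t \<le> u \<Longrightarrow> \<bar>sub_empirical T Y n \<omega> t - cdf \<nu> t\<bar> \<le> e"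
    and risk: "\<And>t. t \<le> u \<Longrightarrow> \<bar>num_at_risk T Y n \<omega> t / n - B t\<bar> \<le> e"
    and B: "antimono_on {..u} B" and c: "0 < c" "\<And>t. t \<le> u \<Longrightarrow> c \<le> B t"
    and hazard: "(LINT y:{..x}|\<nu>. 1 / B y) = - ln (S x)" and S: "0 < S x" "S x \<le> 1"
    and e: "e \<le> c / 8" and x: "x \<le> u"
  shows "\<bar>kaplan_meier T Y n \<omega> x - (1 - S x)\<bar> \<le> (18 / c\<^sup>2 + 2 / c) * e"
proof -
  let ?E = "event_measure T Y n \<omega>"
  interpret E: finite_borel_measure ?E by (rule finite_borel_measure_event_measure)
  define J where "J = {t. t \<le> x \<and> 0 < jump_events T Y n \<omega> t}"
  define a where "a t = jump_events T Y n \<omega> t / n" for t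
  define R where "R t = num_at_risk T Y n \<omega> t / n" for t
  define d where "d t = a t / R t" for t
  have finJ: "finite J" using finite_jumps[of T Y n \<omega>] unfolding J_def by (rule finite_subset[rotated]) auto
  have close': "\<bar>cdf ?E t - cdf \<nu> t\<bar> \<le> e" if "t \<le> u" for t
    using close[OF that] by (simp add: cdf_event_measure)
  have e0: "0 \<le> e" using close[OF x] by simp
  have a_meas: "a t = measure ?E {t}" for t
    using n by (simp add: a_def jump_events_eq measure_event_measure)
  have a0: "0 \<le> a t" for t by (simp add: a_meas)
  \<comment> \<open>As \<open>\<nu>\<close> has no atoms, jumps are small even if several events coincide.\<close>
  have a2: "a t \<le> 2 * e" if "t \<le> u" for t
  proof -
    have "\<bar>measure ?E {t} - measure \<nu> {t}\<bar> \<le> 2 * e"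
      using that by (intro cdf_discrepancy_interval[OF E.finite_borel_measure_axioms \<nu> close'])
        (auto simp: is_interval_1)
    then show ?thesis by (simp add: a_meas atomless)
  qed
  have R: "c / 2 \<le> R t" "\<bar>R t - B t\<bar> \<le> e" if "t \<le> u" for t
  proof -
    show *: "\<bar>R t - B t\<bar> \<le> e" unfolding R_def by (rule risk[OF that])
    have "c / 8 \<le> c / 2" using c(1) by simp
    then show "c / 2 \<le> R t" using * c(2)[OF that] e c(1) by linarith
  qed
  have Ju: "t \<le> u" if "t \<in> J" for t using that x by (simp add: J_def)
  have B0: "0 < B t" if "t \<le> u" for t using c(1) c(2)[OF that] by linarith
  have invB: "1 / B t \<le> 1 / c" if "t \<le> u" for t
    using c(1) c(2)[OF that] by (intro divide_left_mono) auto
  have mono: "mono_on {..x} (\<lambda>y. 1 / B y)"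
    using B x B0 by (intro monotone_onI divide_left_mono) (auto simp: monotone_on_def)
  have bnd: "0 \<le> 1 / B t \<and> 1 / B t \<le> 1 / c" if "t \<in> {..x}" for t
    using that x invB[of t] B0[of t] by auto
  have c0: "0 \<le> 1 / c" using c(1) by simp
  have sum_a: "(\<Sum>t\<in>J. a t) \<le> 1"
  proof -
    have "set_integrable ?E {..x} (\<lambda>_. 1 :: real)"
      by (intro set_integrable_monotone[OF E.finite_borel_measure_axioms, of _ _ 1]) (auto simp: monotone_on_def)
    from sum_jumps_eq_integral[OF this] have "(\<Sum>t\<in>J. a t) = (LINT y:{..x}|?E. 1)"
      by (simp add: J_def a_def)
    also have "\<dots> = measure ?E {..x}" by (simp add: set_lebesgue_integral_def E.borel_UNIV)
    also have "\<dots> = sub_empirical T Y n \<omega> x" using cdf_event_measure[of T Y n \<omega>] by (simp add: cdf_def fun_eq_iff)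
    also have "\<dots> \<le> (\<Sum>i=1..n. 1) / n"
      unfolding sub_empirical_def by (intro divide_right_mono sum_mono) auto
    also have "\<dots> = 1" using n by simp
    finally show ?thesis .
  qed
  have d: "0 \<le> d t" "d t \<le> 4 * e / c" "d t \<le> 1 / 2" "d t \<le> 2 / c * a t" if "t \<in> J" for t
  proof -
    note u = Ju[OF that]
    have R0: "0 < R t" using R(1)[OF u] c(1) by linarith
    show "0 \<le> d t" using R0 a0 by (simp add: d_def)
    have "d t \<le> a t / (c / 2)"
      unfolding d_def using R(1)[OF u] c(1) a0 R0 by (intro divide_left_mono) auto
    then show *: "d t \<le> 2 / c * a t" by (simp add: mult.commute)
    also have "\<dots> \<le> 2 / c * (2 * e)" using a2[OF u] c(1) by (intro mult_left_mono) auto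
    finally show "d t \<le> 4 * e / c" by simp
    also have "\<dots> \<le> 4 * (c / 8) / c" using e c(1) by (intro divide_right_mono mult_left_mono) auto
    also have "\<dots> = 1 / 2" using c(1) by simp
    finally show "d t \<le> 1 / 2" .
  qed
  define P where "P = (\<Prod>t\<in>J. 1 - d t)"
  have KM: "kaplan_meier T Y n \<omega> x = 1 - P"
    using n by (simp add: kaplan_meier_def P_def J_def d_def a_def R_def)
  have pos: "0 < 1 - d t" if "t \<in> J" for t using d(3)[OF that] by simp
  have P: "0 < P" "P \<le> 1"
  proof -
    show "0 < P" unfolding P_def by (intro prod_pos pos)
    have "0 \<le> 1 - d t \<and> 1 - d t \<le> 1" if "t \<in> J" for t using d(1)[OF that] pos[OF that] by simp
    then show "P \<le> 1" unfolding P_def by (rule prod_le_1)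
  qed
  have lnP: "ln P = (\<Sum>t\<in>J. ln (1 - d t))"
    unfolding P_def
  proof (rule ln_prod)
    show "1 - d t \<noteq> 0" if "t \<in> J" for t using pos[OF that] by simp
  qed (rule finJ)
  have ln_step: "\<bar>ln P + (\<Sum>t\<in>J. d t)\<bar> \<le> 16 / c\<^sup>2 * e"
  proof -
    have "\<bar>ln P + (\<Sum>t\<in>J. d t)\<bar> = \<bar>\<Sum>t\<in>J. ln (1 + - d t) - - d t\<bar>"
      by (simp add: lnP sum.distrib)
    also have "\<dots> \<le> (\<Sum>t\<in>J. \<bar>ln (1 + - d t) - - d t\<bar>)" by (rule sum_abs)
    also have "\<dots> \<le> (\<Sum>t\<in>J. 2 * (- d t)\<^sup>2)"
    proof (rule sum_mono)
      fix t assume t: "t \<in> J"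
      show "\<bar>ln (1 + - d t) - - d t\<bar> \<le> 2 * (- d t)\<^sup>2"
        using d(1,3)[OF t] by (intro abs_ln_one_plus_x_minus_x_bound_nonpos) simp_all
    qed
    also have "\<dots> \<le> (\<Sum>t\<in>J. 16 / c\<^sup>2 * e * a t)"
    proof (rule sum_mono)
      fix t assume t: "t \<in> J"
      have "d t * d t \<le> (4 * e / c) * (2 / c * a t)"
        using d[OF t] by (intro mult_mono) auto
      then show "2 * (- d t)\<^sup>2 \<le> 16 / c\<^sup>2 * e * a t" by (simp add: power2_eq_square)
    qed
    also have "\<dots> = 16 / c\<^sup>2 * e * (\<Sum>t\<in>J. a t)" by (simp add: sum_distrib_left)
    also have "\<dots> \<le> 16 / c\<^sup>2 * e * 1" using sum_a e0 by (intro mult_left_mono) auto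
    finally show ?thesis by simp
  qed
  have risk_step: "\<bar>(\<Sum>t\<in>J. d t) - (\<Sum>t\<in>J. a t * (1 / B t))\<bar> \<le> 2 / c\<^sup>2 * e"
  proof -
    have "\<bar>(\<Sum>t\<in>J. d t) - (\<Sum>t\<in>J. a t * (1 / B t))\<bar> \<le> (\<Sum>t\<in>J. \<bar>d t - a t * (1 / B t)\<bar>)"
      unfolding sum_subtractf[symmetric] by (rule sum_abs)
    also have "\<dots> \<le> (\<Sum>t\<in>J. 2 / c\<^sup>2 * e * a t)"
    proof (rule sum_mono)
      fix t assume t: "t \<in> J"
      note u = Ju[OF t]
      have R0: "0 < R t" using R(1)[OF u] c(1) by linarith
      have "d t - a t * (1 / B t) = a t * ((B t - R t) / (R t * B t))"
        using R0 B0[OF u] by (simp add: d_def field_simps)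
      then have "\<bar>d t - a t * (1 / B t)\<bar> = a t * (\<bar>B t - R t\<bar> / (R t * B t))"
        using R0 B0[OF u] a0[of t] by (simp add: abs_mult)
      also have "\<dots> \<le> a t * (e / (c / 2 * c))"
        using R[OF u] c(1) c(2)[OF u] a0[of t] e0 R0 B0[OF u]
        by (intro mult_left_mono frac_le mult_mono) (auto simp: abs_minus_commute)
      finally show "\<bar>d t - a t * (1 / B t)\<bar> \<le> 2 / c\<^sup>2 * e * a t"
        by (simp add: power2_eq_square mult_ac)
    qed
    also have "\<dots> = 2 / c\<^sup>2 * e * (\<Sum>t\<in>J. a t)" by (simp add: sum_distrib_left)
    also have "\<dots> \<le> 2 / c\<^sup>2 * e * 1" using sum_a e0 by (intro mult_left_mono) auto
    finally show ?thesis by simp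
  qed
  have int_step: "\<bar>(\<Sum>t\<in>J. a t * (1 / B t)) - - ln (S x)\<bar> \<le> 2 / c * e"
  proof -
    have "set_integrable ?E {..x} (\<lambda>y. 1 / B y)"
      using bnd c0 mono by (intro set_integrable_monotone[OF E.finite_borel_measure_axioms, of _ _ "1 / c"]) auto
    from sum_jumps_eq_integral[OF this]
    have "(\<Sum>t\<in>J. a t * (1 / B t)) = (LINT y:{..x}|?E. 1 / B y)" by (simp add: J_def a_def)
    moreover have "\<bar>(LINT y:{..x}|?E. 1 / B y) - (LINT y:{..x}|\<nu>. 1 / B y)\<bar> \<le> 1 / c * (2 * e)"
      using mono x by (intro integral_discrepancy_monotone[OF E.finite_borel_measure_axioms \<nu> close' _ _ bnd c0]) auto
    ultimately show ?thesis by (simp add: hazard)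
  qed
  have "\<bar>kaplan_meier T Y n \<omega> x - (1 - S x)\<bar> = \<bar>P - S x\<bar>" by (simp add: KM abs_minus_commute)
  also have "\<dots> \<le> \<bar>ln P - ln (S x)\<bar>" by (rule abs_diff_le_abs_ln_diff[OF P S])
  also have "\<dots> \<le> 16 / c\<^sup>2 * e + 2 / c\<^sup>2 * e + 2 / c * e"
    using ln_step risk_step int_step by linarith
  also have "\<dots> = (18 / c\<^sup>2 + 2 / c) * e" by (simp add: field_simps)
  finally show ?thesis .
qed

section \<open>Hoeffding inequalities under negative association\<close>

text \<open>
  A product of nonnegative functions in a common direction is again monotone in that direction, so
  each further factor can be split off by negative association.
\<close>

lemma (in prob_space) neg_assoc_expectation_prod_le:
  fixes u :: "'i \<Rightarrow> real \<Rightarrow> real"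
  assumes NA: "neg_assoc_family M I T"
    and T: "\<And>i. i \<in> I \<Longrightarrow> T i \<in> borel_measurable M"
    and u: "\<And>i. i \<in> I \<Longrightarrow> u i \<in> borel_measurable borel"
    and bnd: "\<And>i x. i \<in> I \<Longrightarrow> 0 \<le> u i x \<and> u i x \<le> K"
    and mono: "(\<forall>i\<in>I. mono (u i)) \<or> (\<forall>i\<in>I. antimono (u i))"
    and A: "finite A" "A \<subseteq> I"
  shows "expectation (\<lambda>\<omega>. \<Prod>i\<in>A. u i (T i \<omega>)) \<le> (\<Prod>i\<in>A. expectation (\<lambda>\<omega>. u i (T i \<omega>)))"
  using A
proof (induction A)
  case empty
  show ?case by (simp add: prob_space)
next
  case (insert j A)
  define f1 :: "('i \<Rightarrow> real) \<Rightarrow> real" where "f1 x = (\<Prod>i\<in>A. u i (x i))" for x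
  define f2 :: "('i \<Rightarrow> real) \<Rightarrow> real" where "f2 x = u j (x j)" for x
  define U where "U \<omega> = (\<Prod>i\<in>A. u i (T i \<omega>))" for \<omega>
  define V where "V \<omega> = u j (T j \<omega>)" for \<omega>
  have sub: "A \<subseteq> I" "{j} \<subseteq> I" "j \<in> I" using insert by auto
  have fU: "f1 (\<lambda>i\<in>A. T i \<omega>) = U \<omega>" for \<omega> by (simp add: f1_def U_def)
  have fV: "f2 (\<lambda>i\<in>{j}. T i \<omega>) = V \<omega>" for \<omega> by (simp add: f2_def V_def)
  have Um: "U \<in> borel_measurable M"
    unfolding U_def using T u sub by (intro borel_measurable_prod measurable_compose[OF T u]) auto
  have Vm: "V \<in> borel_measurable M"
    unfolding V_def using sub by (intro measurable_compose[OF T u])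
  have Ub: "0 \<le> U \<omega>" "U \<omega> \<le> K ^ card A" for \<omega>
  proof -
    show "0 \<le> U \<omega>" unfolding U_def using bnd sub by (intro prod_nonneg) auto
    have "U \<omega> \<le> (\<Prod>i\<in>A. K)" unfolding U_def using bnd sub by (intro prod_mono) auto
    then show "U \<omega> \<le> K ^ card A" by simp
  qed
  have Vb: "0 \<le> V \<omega>" "V \<omega> \<le> K" for \<omega> unfolding V_def using bnd sub by auto
  have iU: "integrable M U"
    using Ub Um by (intro integrable_const_bound[of _ "K ^ card A"]) auto
  have iV: "integrable M V"
    using Vb Vm by (intro integrable_const_bound[of _ K]) auto
  have iUV: "integrable M (\<lambda>\<omega>. U \<omega> * V \<omega>)"
  proof (rule integrable_const_bound[of _ "K ^ card A * K"])
    show "AE \<omega> in M. norm (U \<omega> * V \<omega>) \<le> K ^ card A * K"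
      using Ub Vb by (intro AE_I2) (auto simp: abs_mult intro!: mult_mono order_trans[OF Ub])
  qed (use Um Vm in auto)
  have "covariance M (\<lambda>\<omega>. f1 (\<lambda>i\<in>A. T i \<omega>)) (\<lambda>\<omega>. f2 (\<lambda>i\<in>{j}. T i \<omega>)) \<le> 0"
  proof (rule NA[unfolded neg_assoc_family_def, rule_format])
    show "A \<subseteq> I" "{j} \<subseteq> I" "A \<inter> {j} = {}" using insert by auto
    have "(\<lambda>x. u i (x i)) \<in> borel_measurable (Pi\<^sub>M B (\<lambda>_. borel))" if "i \<in> B" "i \<in> I" for i B
      by (rule measurable_compose[OF measurable_component_singleton[OF that(1)] u[OF that(2)]])
    then show "f1 \<in> borel_measurable (Pi\<^sub>M A (\<lambda>_. borel))" "f2 \<in> borel_measurable (Pi\<^sub>M {j} (\<lambda>_. borel))"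
      unfolding f1_def f2_def using sub by (auto intro!: borel_measurable_prod)
    show "mono_on (A \<rightarrow>\<^sub>E UNIV) f1 \<and> mono_on ({j} \<rightarrow>\<^sub>E UNIV) f2 \<or>
        antimono_on (A \<rightarrow>\<^sub>E UNIV) f1 \<and> antimono_on ({j} \<rightarrow>\<^sub>E UNIV) f2"
      using mono
    proof
      assume m: "\<forall>i\<in>I. mono (u i)"
      have "f1 x \<le> f1 y" if "x \<le> y" for x y
        unfolding f1_def using bnd sub m that
        by (intro prod_mono) (auto simp: le_fun_def mono_def)
      moreover have "f2 x \<le> f2 y" if "x \<le> y" for x y
        unfolding f2_def using sub m that by (auto simp: le_fun_def mono_def)
      ultimately show ?thesis by (simp add: monotone_on_def)
    next
      assume m: "\<forall>i\<in>I. antimono (u i)"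
      have "f1 y \<le> f1 x" if "x \<le> y" for x y
        unfolding f1_def using bnd sub m that
        by (intro prod_mono) (auto simp: le_fun_def monotone_def)
      moreover have "f2 y \<le> f2 x" if "x \<le> y" for x y
        unfolding f2_def using sub m that by (auto simp: le_fun_def monotone_def)
      ultimately show ?thesis by (simp add: monotone_on_def)
    qed
    show "covariance_exists M (\<lambda>\<omega>. f1 (\<lambda>i\<in>A. T i \<omega>)) (\<lambda>\<omega>. f2 (\<lambda>j\<in>{j}. T j \<omega>))"
      unfolding covariance_exists_def fU fV using iU iV iUV by blast
  qed
  then have cov: "covariance M U V \<le> 0" by (simp only: fU fV)
  have "covariance M U V =
      expectation (\<lambda>\<omega>. U \<omega> * V \<omega> - expectation U * V \<omega> - expectation V * U \<omega> + expectation U * expectation V)"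
    unfolding covariance_def by (intro Bochner_Integration.integral_cong) (auto simp: algebra_simps)
  also have "\<dots> = expectation (\<lambda>\<omega>. U \<omega> * V \<omega>) - expectation U * expectation V"
    using iU iV iUV by (simp add: prob_space)
  finally have "expectation (\<lambda>\<omega>. U \<omega> * V \<omega>) \<le> expectation U * expectation V" using cov by simp
  also have "\<dots> \<le> (\<Prod>i\<in>A. expectation (\<lambda>\<omega>. u i (T i \<omega>))) * expectation V"
    using insert.IH insert.prems Vb unfolding U_def by (intro mult_right_mono integral_nonneg_AE) auto
  finally show ?case
    using insert.hyps by (simp add: U_def V_def[abs_def] mult.commute)
qed

text \<open>
  The Chernoff bound with Hoeffding's estimate of each moment generating function. In place of a
  factorization under independence, negative association bounds the joint moment generating function
  by the product.
\<close>

lemma (in prob_space) neg_assoc_hoeffding_upper: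
  fixes u :: "'i \<Rightarrow> real \<Rightarrow> real" and I :: "'i set" and e :: real
  assumes NA: "neg_assoc_family M I T" and I: "finite I"
    and T: "\<And>i. i \<in> I \<Longrightarrow> T i \<in> borel_measurable M"
    and u: "\<And>i. i \<in> I \<Longrightarrow> u i \<in> borel_measurable borel"
    and bnd: "\<And>i x. i \<in> I \<Longrightarrow> 0 \<le> u i x \<and> u i x \<le> 1"
    and mono: "(\<forall>i\<in>I. mono (u i)) \<or> (\<forall>i\<in>I. antimono (u i))"
    and e: "0 < e"
  shows "prob {\<omega>\<in>space M. card I * e \<le> (\<Sum>i\<in>I. u i (T i \<omega>) - expectation (\<lambda>\<omega>. u i (T i \<omega>)))}
    \<le> exp (- 2 * real (card I) * e\<^sup>2)"
proof -
  \<comment> \<open>The minimizer of \<open>l\<^sup>2 / 8 - l e\<close>.\<close>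
  define l where "l = 4 * e"
  define m where "m i = expectation (\<lambda>\<omega>. u i (T i \<omega>))" for i
  define v where "v i x = exp (l * (u i x - m i))" for i x
  define n where "n = real (card I)"
  have l: "0 < l" using e by (simp add: l_def)
  have uT: "(\<lambda>\<omega>. u i (T i \<omega>)) \<in> borel_measurable M" if "i \<in> I" for i
    using that by (intro measurable_compose[OF T u])
  have m: "0 \<le> m i" if "i \<in> I" for i
    unfolding m_def using bnd that by (intro integral_nonneg_AE) auto
  have vm: "v i \<in> borel_measurable borel" if "i \<in> I" for i
    unfolding v_def using u[OF that] by measurable
  have vb: "0 \<le> v i x \<and> v i x \<le> exp l" if "i \<in> I" for i x
  proof -
    have "l * (u i x - m i) \<le> l * 1" using l bnd[OF that, of x] m[OF that] by (intro mult_left_mono) auto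
    then show ?thesis by (simp add: v_def)
  qed
  have mono_v: "(\<forall>i\<in>I. mono (v i)) \<or> (\<forall>i\<in>I. antimono (v i))"
    using mono l by (auto simp: v_def monotone_def)
  have mgf: "expectation (\<lambda>\<omega>. v i (T i \<omega>)) \<le> exp (l\<^sup>2 / 8)" if i: "i \<in> I" for i
  proof -
    interpret X: interval_bounded_random_variable M "\<lambda>\<omega>. u i (T i \<omega>)" 0 1
      using bnd[OF i] uT[OF i] by unfold_locales auto
    have "integrable M (\<lambda>\<omega>. v i (T i \<omega>))"
      using vb[OF i] measurable_compose[OF T[OF i] vm[OF i]]
      by (intro integrable_const_bound[of _ "exp l"]) auto
    then have "ennreal (expectation (\<lambda>\<omega>. v i (T i \<omega>))) = (\<integral>\<^sup>+\<omega>. v i (T i \<omega>) \<partial>M)"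
      using vb[OF i] by (intro nn_integral_eq_integral[symmetric]) auto
    also have "\<dots> \<le> ennreal (exp (l\<^sup>2 * (1 - 0)\<^sup>2 / 8))"
      unfolding v_def m_def by (rule X.Hoeffdings_lemma_nn_integral[OF l])
    finally show ?thesis by (simp add: ennreal_le_iff)
  qed
  let ?S = "\<lambda>\<omega>. \<Sum>i\<in>I. u i (T i \<omega>) - m i"
  have expS: "exp (l * ?S \<omega>) = (\<Prod>i\<in>I. v i (T i \<omega>))" for \<omega>
    unfolding v_def sum_distrib_left using I by (simp add: exp_sum)
  have Sm: "?S \<in> borel_measurable M" using uT by measurable
  have iexp: "integrable M (\<lambda>\<omega>. exp (l * ?S \<omega>))"
  proof (rule integrable_const_bound[of _ "exp (l * n)"])
    have "?S \<omega> \<le> (\<Sum>i\<in>I. 1)" for \<omega>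
      using bnd m by (intro sum_mono) (smt (verit))
    then show "AE \<omega> in M. norm (exp (l * ?S \<omega>)) \<le> exp (l * n)"
      using l by (auto simp: n_def)
  qed (use Sm in measurable)
  have "prob {\<omega>\<in>space M. n * e \<le> ?S \<omega>} \<le>
      exp (- l * (n * e)) * (\<integral>\<omega>\<in>space M. exp (l * ?S \<omega>) \<partial>M)"
    using integrable_mult_indicator[OF sets.top iexp]
    by (intro Chernoff_ineq_ge[OF l]) (simp_all add: set_integrable_def)
  also have "\<dots> = expectation (\<lambda>\<omega>. exp (l * ?S \<omega>)) / exp (l * (n * e))"
    using iexp by (simp add: set_integral_space exp_minus field_simps)
  also have "\<dots> \<le> (\<Prod>i\<in>I. expectation (\<lambda>\<omega>. v i (T i \<omega>))) / exp (l * (n * e))"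
    unfolding expS
    by (intro divide_right_mono neg_assoc_expectation_prod_le[OF NA T vm vb mono_v I]) auto
  also have "\<dots> \<le> (\<Prod>i\<in>I. exp (l\<^sup>2 / 8)) / exp (l * (n * e))"
    using mgf vb by (intro divide_right_mono prod_mono) (auto intro!: integral_nonneg_AE)
  also have "\<dots> = exp (n * (l\<^sup>2 / 8) - l * (n * e))"
    by (simp add: exp_diff n_def exp_of_nat_mult[symmetric])
  also have "n * (l\<^sup>2 / 8) - l * (n * e) = - 2 * n * e\<^sup>2"
    by (simp add: l_def power2_eq_square algebra_simps)
  finally show ?thesis by (simp add: n_def m_def)
qed

lemma le_abs_real_iff: "c \<le> \<bar>x\<bar> \<longleftrightarrow> c \<le> x \<or> c \<le> - x" for c x :: real
  by linarith

lemma (in prob_space) neg_assoc_hoeffding: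
  fixes u :: "'i \<Rightarrow> real \<Rightarrow> real" and I :: "'i set" and e :: real
  assumes NA: "neg_assoc_family M I T" and I: "finite I"
    and T: "\<And>i. i \<in> I \<Longrightarrow> T i \<in> borel_measurable M"
    and u: "\<And>i. i \<in> I \<Longrightarrow> u i \<in> borel_measurable borel"
    and bnd: "\<And>i x. i \<in> I \<Longrightarrow> 0 \<le> u i x \<and> u i x \<le> 1"
    and mono: "(\<forall>i\<in>I. mono (u i)) \<or> (\<forall>i\<in>I. antimono (u i))"
    and e: "0 < e"
  shows "prob {\<omega>\<in>space M. card I * e \<le> \<bar>\<Sum>i\<in>I. u i (T i \<omega>) - expectation (\<lambda>\<omega>. u i (T i \<omega>))\<bar>}
    \<le> 2 * exp (- 2 * real (card I) * e\<^sup>2)"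
proof -
  let ?S = "\<lambda>\<omega>. \<Sum>i\<in>I. u i (T i \<omega>) - expectation (\<lambda>\<omega>. u i (T i \<omega>))"
  let ?S' = "\<lambda>\<omega>. \<Sum>i\<in>I. (1 - u i (T i \<omega>)) - expectation (\<lambda>\<omega>. 1 - u i (T i \<omega>))"
  have uT: "(\<lambda>\<omega>. u i (T i \<omega>)) \<in> borel_measurable M" if "i \<in> I" for i
    using that by (intro measurable_compose[OF T u])
  have "expectation (\<lambda>\<omega>. 1 - u i (T i \<omega>)) = 1 - expectation (\<lambda>\<omega>. u i (T i \<omega>))" if i: "i \<in> I" for i
  proof -
    have "integrable M (\<lambda>\<omega>. u i (T i \<omega>))"
      using bnd[OF i] uT[OF i] by (intro integrable_const_bound[of _ 1]) auto
    then show ?thesis by (simp add: prob_space)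
  qed
  then have S': "?S' \<omega> = - ?S \<omega>" for \<omega>
    unfolding sum_negf[symmetric] by (intro sum.cong) auto
  have Sm: "?S \<in> borel_measurable M" using uT by measurable
  have Sm': "?S' \<in> borel_measurable M" using uT by measurable
  let ?U = "{\<omega>\<in>space M. card I * e \<le> ?S \<omega>}" and ?L = "{\<omega>\<in>space M. card I * e \<le> ?S' \<omega>}"
  have split: "{\<omega>\<in>space M. card I * e \<le> \<bar>?S \<omega>\<bar>} = ?U \<union> ?L"
    unfolding S' le_abs_real_iff by blast
  have "prob (?U \<union> ?L) \<le> prob ?U + prob ?L"
    using Sm Sm' by (intro measure_Un_le borel_measurable_le borel_measurable_const)
  also have "\<dots> \<le> exp (- 2 * real (card I) * e\<^sup>2) + exp (- 2 * real (card I) * e\<^sup>2)"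
  proof (rule add_mono)
    show "prob {\<omega>\<in>space M. card I * e \<le> ?S \<omega>} \<le> exp (- 2 * real (card I) * e\<^sup>2)"
      using NA I T u bnd mono e
      by (intro neg_assoc_hoeffding_upper[where u = u and T = T and I = I and e = e]) simp_all
    show "prob {\<omega>\<in>space M. card I * e \<le> ?S' \<omega>} \<le> exp (- 2 * real (card I) * e\<^sup>2)"
    proof (rule neg_assoc_hoeffding_upper[where u = "\<lambda>i x. 1 - u i x" and T = T and I = I and e = e])
      show "(\<forall>i\<in>I. mono (\<lambda>x. 1 - u i x)) \<or> (\<forall>i\<in>I. antimono (\<lambda>x. 1 - u i x))"
        using mono by (simp add: monotone_def) blast
      show "(\<lambda>x. 1 - u i x) \<in> borel_measurable borel" if "i \<in> I" for i
        using u[OF that] by measurable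
      show "0 \<le> 1 - u i x \<and> 1 - u i x \<le> 1" if "i \<in> I" for i x
        using bnd[OF that, of x] by simp
    qed (use NA I T e in simp_all)
  qed
  finally show ?thesis unfolding split by simp
qed

text \<open>
  The deviation is \<open>D + D'\<close>, where \<open>D\<close> centres each \<open>\<phi> (T i) (Y i)\<close> at its conditional mean
  \<open>\<psi> (Y i)\<close> and \<open>D'\<close> centres \<open>\<psi> (Y i)\<close> at its mean. Hoeffding's inequality applies to \<open>D'\<close>
  directly, and to \<open>D\<close> after fixing the whole sequence \<open>Y\<close>: by independence the joint law is a
  product, and the bound is the same on every slice.
\<close>

lemma (in prob_space) neg_assoc_pair_hoeffding:
  fixes T Y :: "nat \<Rightarrow> 'a \<Rightarrow> real" and \<phi> :: "real \<Rightarrow> real \<Rightarrow> real" and P Q :: "real measure"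
  assumes NAT: "neg_assoc_family M {1..n} T" and NAY: "neg_assoc_family M {1..n} Y"
    and T: "\<And>i. 1 \<le> i \<Longrightarrow> T i \<in> borel_measurable M"
    and Y: "\<And>i. 1 \<le> i \<Longrightarrow> Y i \<in> borel_measurable M"
    and ind: "indep_var (Pi\<^sub>M {1..} (\<lambda>_. borel)) (\<lambda>\<omega>. \<lambda>i\<in>{1..}. T i \<omega>)
        (Pi\<^sub>M {1..} (\<lambda>_. borel)) (\<lambda>\<omega>. \<lambda>i\<in>{1..}. Y i \<omega>)"
    and P: "\<And>i. 1 \<le> i \<Longrightarrow> distr M borel (T i) = P"
    and Q: "\<And>i. 1 \<le> i \<Longrightarrow> distr M borel (Y i) = Q"
    and \<phi>: "(\<lambda>(t, y). \<phi> t y) \<in> borel_measurable (borel \<Otimes>\<^sub>M borel)"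
    and bnd: "\<And>t y. 0 \<le> \<phi> t y \<and> \<phi> t y \<le> 1"
    and mono1: "(\<forall>y. mono (\<lambda>t. \<phi> t y)) \<or> (\<forall>y. antimono (\<lambda>t. \<phi> t y))"
    and mono2: "mono (\<lambda>y. \<integral>t. \<phi> t y \<partial>P) \<or> antimono (\<lambda>y. \<integral>t. \<phi> t y \<partial>P)"
    and e: "0 < e"
  shows "prob {\<omega>\<in>space M. 2 * (n * e) \<le> \<bar>\<Sum>i=1..n. \<phi> (T i \<omega>) (Y i \<omega>) - (\<integral>y. \<integral>t. \<phi> t y \<partial>P \<partial>Q)\<bar>}
    \<le> 4 * exp (- 2 * real n * e\<^sup>2)"
proof -
  define \<psi> where "\<psi> y = (\<integral>t. \<phi> t y \<partial>P)" for y
  define m where "m = (\<integral>y. \<psi> y \<partial>Q)"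
  let ?S = "Pi\<^sub>M {1..} (\<lambda>_. borel) :: (nat \<Rightarrow> real) measure"
  let ?T = "\<lambda>\<omega>. \<lambda>i\<in>{1..}. T i \<omega>" and ?Y = "\<lambda>\<omega>. \<lambda>i\<in>{1..}. Y i \<omega>"
  have Ts: "?T \<in> measurable M ?S" and Ys: "?Y \<in> measurable M ?S"
    using ind by (auto dest: indep_var_rv1 indep_var_rv2)
  interpret P: prob_space P using prob_space_distr[OF T[of 1]] P[of 1] by simp
  have setsP [measurable_cong]: "sets P = sets borel" using P[of 1] by auto
  have setsQ [measurable_cong]: "sets Q = sets borel" using Q[of 1] by auto
  have \<phi>m [measurable]: "(\<lambda>x. \<phi> (f x) (g x)) \<in> borel_measurable N"
    if "f \<in> borel_measurable N" "g \<in> borel_measurable N" for f g and N :: "'z measure"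
    using measurable_compose[OF measurable_Pair[OF that] \<phi>] by simp
  have \<psi>m [measurable]: "\<psi> \<in> borel_measurable borel"
    unfolding \<psi>_def using \<phi>
    by (intro P.borel_measurable_lebesgue_integral) (simp add: case_prod_unfold \<phi>m cong: measurable_cong_sets)
  have \<phi>int: "integrable P (\<lambda>t. \<phi> t y)" for y
    using bnd by (intro P.integrable_const_bound[of _ 1]) (auto cong: measurable_cong_sets)
  have \<psi>b: "0 \<le> \<psi> y \<and> \<psi> y \<le> 1" for y
  proof
    show "0 \<le> \<psi> y" unfolding \<psi>_def using bnd by (intro integral_nonneg_AE) auto
    have "\<psi> y \<le> (\<integral>t. 1 \<partial>P)" unfolding \<psi>_def using bnd \<phi>int by (intro integral_mono) auto
    then show "\<psi> y \<le> 1" by (simp add: P.prob_space)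
  qed
  define D where "D \<omega> = (\<Sum>i=1..n. \<phi> (T i \<omega>) (Y i \<omega>) - \<psi> (Y i \<omega>))" for \<omega>
  define D' where "D' \<omega> = (\<Sum>i=1..n. \<psi> (Y i \<omega>) - m)" for \<omega>
  have Tm: "T i \<in> borel_measurable M" "Y i \<in> borel_measurable M" if "i \<in> {1..n}" for i
    using that T Y by auto
  have Dm: "D \<in> borel_measurable M" unfolding D_def
    by (intro borel_measurable_sum borel_measurable_diff \<phi>m measurable_compose[OF _ \<psi>m] Tm)
  have D'm: "D' \<in> borel_measurable M" unfolding D'_def
    by (intro borel_measurable_sum borel_measurable_diff borel_measurable_const measurable_compose[OF _ \<psi>m] Tm)
  have card: "real (card {1..n}) = n" by simp
  have second: "prob {\<omega>\<in>space M. n * e \<le> \<bar>D' \<omega>\<bar>} \<le> 2 * exp (- 2 * real n * e\<^sup>2)"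
  proof -
    have "expectation (\<lambda>\<omega>. \<psi> (Y i \<omega>)) = m" if "i \<in> {1..n}" for i
      using that Y[of i] Q[of i] unfolding m_def by (subst integral_distr[symmetric, of "Y i" M borel \<psi>]) auto
    then have D'_eq: "D' \<omega> = (\<Sum>i\<in>{1..n}. \<psi> (Y i \<omega>) - expectation (\<lambda>\<omega>. \<psi> (Y i \<omega>)))" for \<omega>
      unfolding D'_def by (intro sum.cong) auto
    show ?thesis
      unfolding D'_eq card[symmetric]
    proof (rule neg_assoc_hoeffding[where u = "\<lambda>_. \<psi>" and T = Y and I = "{1..n}" and e = e])
      show "(\<forall>i\<in>{1..n}. mono \<psi>) \<or> (\<forall>i\<in>{1..n}. antimono \<psi>)"
        using mono2 unfolding \<psi>_def[abs_def] by blast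
    qed (use NAY Tm e \<psi>b in auto)
  qed
  \<comment> \<open>The event \<open>n * e \<le> \<bar>D\<bar>\<close>, as a set of pairs of sequences.\<close>
  define Z where "Z = {z \<in> space (?S \<Otimes>\<^sub>M ?S). n * e \<le> \<bar>\<Sum>i=1..n. \<phi> (fst z i) (snd z i) - \<psi> (snd z i)\<bar>}"
  have Zm: "Z \<in> sets (?S \<Otimes>\<^sub>M ?S)"
  proof -
    have "(\<lambda>z. fst z i) \<in> borel_measurable (?S \<Otimes>\<^sub>M ?S)" "(\<lambda>z. snd z i) \<in> borel_measurable (?S \<Otimes>\<^sub>M ?S)"
      if "i \<in> {1..n}" for i
      using that by (auto intro!: measurable_compose[OF measurable_fst] measurable_compose[OF measurable_snd]
          measurable_component_singleton)
    then have "(\<lambda>z. \<Sum>i=1..n. \<phi> (fst z i) (snd z i) - \<psi> (snd z i)) \<in> borel_measurable (?S \<Otimes>\<^sub>M ?S)"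
      by (intro borel_measurable_sum borel_measurable_diff \<phi>m measurable_compose[OF _ \<psi>m])
    then show ?thesis unfolding Z_def
      by (intro borel_measurable_le borel_measurable_const borel_measurable_abs)
  qed
  have first: "prob {\<omega>\<in>space M. n * e \<le> \<bar>D \<omega>\<bar>} \<le> 2 * exp (- 2 * real n * e\<^sup>2)"
  proof -
    let ?DT = "distr M ?S ?T" and ?DY = "distr M ?S ?Y"
    interpret DT: prob_space ?DT by (rule prob_space_distr[OF Ts])
    interpret DY: prob_space ?DY by (rule prob_space_distr[OF Ys])
    interpret pair_sigma_finite ?DT ?DY ..
    have joint: "?DT \<Otimes>\<^sub>M ?DY = distr M (?S \<Otimes>\<^sub>M ?S) (\<lambda>\<omega>. (?T \<omega>, ?Y \<omega>))"
      using ind unfolding indep_var_distribution_eq by blast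
    have slice: "emeasure ?DT ((\<lambda>t. (t, y)) -` Z) \<le> ennreal (2 * exp (- 2 * real n * e\<^sup>2))"
      if y: "y \<in> space ?S" for y
    proof -
      have Zs: "(\<lambda>t. (t, y)) -` Z \<in> sets ?S" using Zm by (rule sets_Pair2)
      have "emeasure ?DT ((\<lambda>t. (t, y)) -` Z) = emeasure M (?T -` ((\<lambda>t. (t, y)) -` Z) \<inter> space M)"
        by (rule emeasure_distr[OF Ts Zs])
      also have "?T -` ((\<lambda>t. (t, y)) -` Z) \<inter> space M =
          {\<omega>\<in>space M. n * e \<le> \<bar>\<Sum>i\<in>{1..n}. \<phi> (T i \<omega>) (y i) - expectation (\<lambda>\<omega>. \<phi> (T i \<omega>) (y i))\<bar>}"
      proof -
        have "expectation (\<lambda>\<omega>. \<phi> (T i \<omega>) (y i)) = \<psi> (y i)" if "i \<in> {1..n}" for i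
          using that T[of i] P[of i] unfolding \<psi>_def
          by (subst integral_distr[symmetric, of "T i" M borel "\<lambda>t. \<phi> t (y i)"]) auto
        then have "(\<Sum>i\<in>{1..n}. \<phi> (T i \<omega>) (y i) - expectation (\<lambda>\<omega>. \<phi> (T i \<omega>) (y i))) =
            (\<Sum>i\<in>{1..n}. \<phi> (?T \<omega> i) (y i) - \<psi> (y i))" for \<omega>
          by (intro sum.cong) auto
        then show ?thesis
          using y measurable_space[OF Ts] by (auto simp: Z_def space_pair_measure)
      qed
      also have "emeasure M \<dots> = ennreal (prob \<dots>)" by (rule emeasure_eq_measure)
      also have "\<dots> \<le> ennreal (2 * exp (- 2 * real n * e\<^sup>2))"
        unfolding card[symmetric]
      proof (intro ennreal_leI neg_assoc_hoeffding[where u = "\<lambda>i t. \<phi> t (y i)" and T = T and I = "{1..n}" and e = e])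
        show "(\<forall>i\<in>{1..n}. mono (\<lambda>t. \<phi> t (y i))) \<or> (\<forall>i\<in>{1..n}. antimono (\<lambda>t. \<phi> t (y i)))"
          using mono1 by blast
      qed (use NAT Tm e bnd in auto)
      finally show ?thesis .
    qed
    have eq: "{\<omega>\<in>space M. n * e \<le> \<bar>D \<omega>\<bar>} = (\<lambda>\<omega>. (?T \<omega>, ?Y \<omega>)) -` Z \<inter> space M"
    proof -
      have "D \<omega> = (\<Sum>i=1..n. \<phi> (?T \<omega> i) (?Y \<omega> i) - \<psi> (?Y \<omega> i))" for \<omega>
        unfolding D_def by (intro sum.cong) auto
      then show ?thesis
        using measurable_space[OF Ts] measurable_space[OF Ys] by (auto simp: Z_def space_pair_measure)
    qed
    have "ennreal (prob {\<omega>\<in>space M. n * e \<le> \<bar>D \<omega>\<bar>}) = emeasure (?DT \<Otimes>\<^sub>M ?DY) Z"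
      unfolding eq joint emeasure_eq_measure[symmetric]
      by (rule emeasure_distr[symmetric, OF measurable_Pair[OF Ts Ys] Zm])
    also have "\<dots> = (\<integral>\<^sup>+y. emeasure ?DT ((\<lambda>t. (t, y)) -` Z) \<partial>?DY)"
    proof (rule emeasure_pair_measure_alt2)
      have "sets (?DT \<Otimes>\<^sub>M ?DY) = sets (?S \<Otimes>\<^sub>M ?S)" by (intro sets_pair_measure_cong sets_distr)
      then show "Z \<in> sets (?DT \<Otimes>\<^sub>M ?DY)" using Zm by (simp only:)
    qed
    also have "\<dots> \<le> (\<integral>\<^sup>+y. ennreal (2 * exp (- 2 * real n * e\<^sup>2)) \<partial>?DY)"
      using slice by (intro nn_integral_mono) simp
    also have "\<dots> = ennreal (2 * exp (- 2 * real n * e\<^sup>2))"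
      using DY.emeasure_space_1 by simp
    finally show ?thesis by (simp add: ennreal_le_iff)
  qed
  have sum_eq: "(\<Sum>i=1..n. \<phi> (T i \<omega>) (Y i \<omega>) - m) = D \<omega> + D' \<omega>" for \<omega>
    unfolding D_def D'_def sum.distrib[symmetric] by (intro sum.cong) auto
  let ?A = "{\<omega>\<in>space M. n * e \<le> \<bar>D \<omega>\<bar>}" and ?B = "{\<omega>\<in>space M. n * e \<le> \<bar>D' \<omega>\<bar>}"
  have AB: "?A \<in> events" "?B \<in> events"
    by (intro borel_measurable_le borel_measurable_const borel_measurable_abs Dm D'm)+
  have "prob {\<omega>\<in>space M. 2 * (n * e) \<le> \<bar>\<Sum>i=1..n. \<phi> (T i \<omega>) (Y i \<omega>) - m\<bar>} \<le> prob (?A \<union> ?B)"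
  proof (rule finite_measure_mono)
    show "{\<omega>\<in>space M. 2 * (n * e) \<le> \<bar>\<Sum>i=1..n. \<phi> (T i \<omega>) (Y i \<omega>) - m\<bar>} \<subseteq> ?A \<union> ?B"
      unfolding sum_eq by (auto simp: not_le)
  qed (use AB in auto)
  also have "prob (?A \<union> ?B) \<le> prob ?A + prob ?B" by (rule measure_Un_le[OF AB])
  also have "\<dots> \<le> 4 * exp (- 2 * real n * e\<^sup>2)" using first second by simp
  finally show ?thesis unfolding m_def \<psi>_def .
qed

section \<open>From pointwise tails to uniform almost sure rates\<close>

text \<open>
  The grid consists of \<open>u\<close> and one point at each level \<open>j / n\<close> that \<open>H\<close> attains on \<open>{..u}\<close>. Below
  the level \<open>1 / n\<close> there may be no grid point to the left of \<open>x\<close>, whence the alternative in the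
  last conclusion.
\<close>

lemma quantile_grid:
  fixes H :: "real \<Rightarrow> real" and n :: nat
  assumes mono: "mono H" and cont: "continuous_on UNIV H"
    and bot: "(H \<longlongrightarrow> 0) at_bot" and le1: "\<And>x. H x \<le> 1" and n: "1 \<le> n"
  obtains G where "finite G" "card G \<le> n + 1"
    "\<And>x. x \<le> u \<Longrightarrow> \<exists>p\<in>G. x \<le> p \<and> H p \<le> H x + 1 / n"
    "\<And>x. x \<le> u \<Longrightarrow> H x \<le> 1 / n \<or> (\<exists>q\<in>G. q \<le> x \<and> H x \<le> H q + 1 / n)"
proof -
  define J where "J = {j\<in>{1..n}. j / n \<le> H u}"
  have "\<exists>x\<le>u. H x = j / n" if "j \<in> J" for j
  proof -
    have "0 < j / n" using that n by (auto simp: J_def)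
    then have "\<forall>\<^sub>F x in at_bot. H x < j / n" by (rule order_tendstoD(2)[OF bot])
    then have "\<forall>\<^sub>F x in at_bot. H x < j / n \<and> x \<le> u" by (intro eventually_conj eventually_le_at_bot)
    then obtain a where "H a < j / n" "a \<le> u" using eventually_happens'[OF trivial_limit_at_bot_linorder] by blast
    then have "\<exists>x\<ge>a. x \<le> u \<and> H x = j / n"
      using that cont by (intro IVT') (auto simp: J_def intro: continuous_on_subset)
    then show ?thesis by blast
  qed
  then obtain pt where pt: "\<And>j. j \<in> J \<Longrightarrow> pt j \<le> u \<and> H (pt j) = j / n" by metis
  have n0: "0 < real n" using n by simp
  have less: "x < y" if "H x < H y" for x y using mono that by (meson mono_strict_invE)
  show thesis
  proof
    let ?G = "insert u (pt ` J)"
    have "J \<subseteq> {1..n}" unfolding J_def by blast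
    then have finJ: "finite J" "card J \<le> n"
      using card_mono[of "{1..n}" J] by (auto intro: finite_subset)
    show "finite ?G" using finJ by simp
    show "card ?G \<le> n + 1"
      using finJ card_image_le[OF finJ(1), of pt] card_insert_le_m1[of "n+1" "pt ` J" u] by simp
    have H0: "0 \<le> H x" for x
      by (rule tendsto_upperbound[OF bot _ trivial_limit_at_bot_linorder])
        (use mono in \<open>auto simp: eventually_at_bot_linorder mono_def intro!: exI[of _ x]\<close>)
    fix x assume x: "x \<le> u"
    have Hxu: "H x \<le> H u" using mono x by (simp add: mono_def)
    \<comment> \<open>The first level above \<open>H x\<close> is \<open>(k + 1) / n\<close>; if it exceeds \<open>H u\<close>, then \<open>u\<close> takes its place.\<close>
    define k where "k = nat \<lfloor>H x * n\<rfloor>"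
    have k: "real k \<le> H x * n" "H x * n < real k + 1"
      using H0[of x] n0 by (auto simp: k_def)
    have k': "(real k + 1) / n \<le> H x + 1 / n" "H x < (real k + 1) / n"
      using k n0 by (auto simp: field_simps)
    show "\<exists>p\<in>?G. x \<le> p \<and> H p \<le> H x + 1 / n"
    proof (cases "Suc k \<in> J")
      case True
      then have "H (pt (Suc k)) = (real k + 1) / n" using pt[OF True] by (simp add: add.commute)
      then show ?thesis using True k' less[of x "pt (Suc k)"] by (intro bexI[of _ "pt (Suc k)"]) auto
    next
      case False
      have "H u \<le> H x + 1 / n"
      proof (rule ccontr)
        assume "\<not> H u \<le> H x + 1 / n"
        then have *: "(real k + 1) / n < H u" using k' by linarith
        then have "(real k + 1) / n < 1" using le1[of u] by linarith
        then have "Suc k \<in> {1..n}" using n0 by (simp add: divide_less_eq)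
        with * False show False by (simp add: J_def add.commute)
      qed
      then show ?thesis using x by (intro bexI[of _ u]) auto
    qed
    \<comment> \<open>The last level strictly below \<open>H x\<close>; strictness puts the point of that level to the left of \<open>x\<close>.\<close>
    define l where "l = nat (\<lceil>H x * n\<rceil> - 1)"
    show "H x \<le> 1 / n \<or> (\<exists>q\<in>?G. q \<le> x \<and> H x \<le> H q + 1 / n)"
    proof (cases "H x \<le> 1 / n")
      case False
      then have big: "1 < H x * n" using n0 by (simp add: field_simps)
      have l: "real l < H x * n" "H x * n \<le> real l + 1" "1 \<le> l"
        using big by (auto simp: l_def) linarith+
      have l': "real l / n < H x" "H x \<le> (real l + 1) / n"
        using l n0 by (auto simp: field_simps)
      have "real l / n < 1" using l'(1) le1[of x] by linarith
      then have "l \<le> n" using n0 by (simp add: divide_less_eq)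
      moreover have "real l / n \<le> H u" using l'(1) Hxu by linarith
      ultimately have "l \<in> J" using l(3) by (simp add: J_def)
      then have q: "H (pt l) = l / n" using pt by blast
      have "pt l < x" using l'(1) q by (intro less[of "pt l" x]) simp
      moreover have "H x \<le> H (pt l) + 1 / n" using l'(2) by (simp add: q add_divide_distrib)
      ultimately show ?thesis using \<open>l \<in> J\<close> by (intro disjI2 bexI[of _ "pt l"]) auto
    qed simp
  qed
qed

text \<open>
  Monotonicity carries the bound from the grid to all of \<open>{..u}\<close> with an additional \<open>1 / n\<close>.
\<close>

lemma (in prob_space) uniform_rate_of_pointwise_tails:
  fixes H :: "real \<Rightarrow> real" and K :: "nat \<Rightarrow> 'a \<Rightarrow> real \<Rightarrow> real"
  assumes mono: "mono H" and cont: "continuous_on UNIV H"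
    and bot: "(H \<longlongrightarrow> 0) at_bot" and le1: "\<And>x. H x \<le> 1"
    and monoK: "\<And>n \<omega>. mono (K n \<omega>)" and K0: "\<And>n \<omega> x. 0 \<le> K n \<omega> x"
    and Km: "\<And>n x. (\<lambda>\<omega>. K n \<omega> x) \<in> borel_measurable M"
    and tail: "\<And>n x e. 1 \<le> n \<Longrightarrow> 0 < e \<Longrightarrow>
      prob {\<omega>\<in>space M. 2 * e \<le> \<bar>K n \<omega> x - H x\<bar>} \<le> 4 * exp (- 2 * real n * e\<^sup>2)"
  shows "AE \<omega> in M. \<forall>\<^sub>F n in sequentially. \<forall>x\<le>u. \<bar>K n \<omega> x - H x\<bar> \<le> 5 * sqrt (ln (real n) / real n)"
proof -
  define r where "r n = sqrt (ln (real n) / real n)" for n :: nat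
  \<comment> \<open>For \<open>n = 0\<close> the empty grid is chosen.\<close>
  have "\<exists>G. finite G \<and> card G \<le> n + 1 \<and> (1 \<le> n \<longrightarrow>
      (\<forall>x\<le>u. \<exists>p\<in>G. x \<le> p \<and> H p \<le> H x + 1 / n) \<and>
      (\<forall>x\<le>u. H x \<le> 1 / n \<or> (\<exists>q\<in>G. q \<le> x \<and> H x \<le> H q + 1 / n)))" for n :: nat
  proof (cases "1 \<le> n")
    case True
    show ?thesis using quantile_grid[OF mono cont bot le1 True, of u] by metis
  qed (auto intro: exI[of _ "{}"])
  then obtain G :: "nat \<Rightarrow> real set" where G: "\<And>n. finite (G n)" "\<And>n. card (G n) \<le> n + 1"
    "\<And>n x. 1 \<le> n \<Longrightarrow> x \<le> u \<Longrightarrow> \<exists>p\<in>G n. x \<le> p \<and> H p \<le> H x + 1 / n"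
    "\<And>n x. 1 \<le> n \<Longrightarrow> x \<le> u \<Longrightarrow> H x \<le> 1 / n \<or> (\<exists>q\<in>G n. q \<le> x \<and> H x \<le> H q + 1 / n)"
    by metis
  \<comment> \<open>For \<open>e = 2 * r n\<close> the tail bound is \<open>4 / n ^ 8\<close>, summable even after multiplication with the
    size of the grid.\<close>
  define B where "B n p = {\<omega>\<in>space M. 2 * (2 * r n) \<le> \<bar>K n \<omega> p - H p\<bar>}" for n p
  define A where "A n = (\<Union>p\<in>G n. B n p)" for n
  have Bm: "B n p \<in> events" for n p
    unfolding B_def by (intro borel_measurable_le borel_measurable_const borel_measurable_abs borel_measurable_diff Km)
  have Am: "A n \<in> events" for n unfolding A_def using G(1) Bm by auto
  have Abound: "prob (A n) \<le> 8 * (1 / real n ^ 2)" if n: "2 \<le> n" for n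
  proof -
    have r: "0 < r n" "(r n)\<^sup>2 = ln n / n" using n by (auto simp: r_def)
    have "prob (B n p) \<le> 4 * (1 / real n ^ 8)" for p
    proof -
      have "prob (B n p) \<le> 4 * exp (- 2 * real n * (2 * r n)\<^sup>2)"
        unfolding B_def using n r by (intro tail) auto
      also have "- 2 * real n * (2 * r n)\<^sup>2 = - (8 * ln n)"
        using n by (simp add: power_mult_distrib r)
      also have "exp (- (8 * ln n)) = 1 / real n ^ 8"
        using n exp_of_nat_mult[of 8 "ln (real n)"] by (simp add: exp_minus field_simps)
      finally show ?thesis .
    qed
    then have "(\<Sum>p\<in>G n. prob (B n p)) \<le> (\<Sum>p\<in>G n. 4 * (1 / real n ^ 8))" by (intro sum_mono)
    moreover have "prob (A n) \<le> (\<Sum>p\<in>G n. prob (B n p))"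
      unfolding A_def using G(1) Bm by (intro measure_UNION_le) auto
    ultimately have "prob (A n) \<le> real (card (G n)) * (4 * (1 / real n ^ 8))" by simp
    also have "\<dots> \<le> (2 * real n) * (4 * (1 / real n ^ 8))"
      using G(2)[of n] n by (intro mult_right_mono) auto
    also have "\<dots> = 8 * (real n / real n ^ 8)" by simp
    also have "real n / real n ^ 8 \<le> 1 / real n ^ 2"
    proof -
      have "real n ^ 3 \<le> real n ^ 8" using n by (intro power_increasing) auto
      then show ?thesis using n by (simp add: divide_simps power2_eq_square power3_eq_cube mult_ac)
    qed
    finally show ?thesis by simp
  qed
  have "summable (\<lambda>n. prob (A n))"
  proof (rule summable_comparison_test_ev)
    show "\<forall>\<^sub>F n in sequentially. norm (prob (A n)) \<le> 8 * (1 / real n ^ 2)"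
      using Abound by (auto intro: eventually_sequentiallyI[of 2])
    show "summable (\<lambda>n. 8 * (1 / real n ^ 2))"
      using inverse_power_summable[of 2, where 'a = real] by (intro summable_mult) (simp add: inverse_eq_divide)
  qed
  then have "AE \<omega> in M. \<forall>\<^sub>F n in sequentially. \<omega> \<in> space M - A n"
    using Am by (intro borel_cantelli_AE1) (auto simp: emeasure_eq_measure)
  then show ?thesis
  proof eventually_elim
    case (elim \<omega>)
    have "\<forall>\<^sub>F n in sequentially. 3 \<le> n" by (rule eventually_ge_at_top)
    with elim show ?case
    proof eventually_elim
      case (elim n)
      then have n: "1 \<le> n" by simp
      have close: "\<bar>K n \<omega> p - H p\<bar> \<le> 4 * r n" if "p \<in> G n" for p
        using elim that by (auto simp: A_def B_def not_le)
      have rn: "1 / n \<le> r n" "0 \<le> r n"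
      proof -
        have "exp 1 \<le> real n" using elim exp_le by linarith
        then have "1 \<le> ln (real n)" using n by (simp add: ln_ge_iff)
        then have "(1 / n) \<le> ln (real n)" using n by (smt (verit) divide_le_eq_1_pos of_nat_1 of_nat_le_iff)
        then have "(1 / real n)\<^sup>2 \<le> ln (real n) / n" using n by (simp add: power2_eq_square divide_simps)
        then show "1 / n \<le> r n" unfolding r_def by (rule real_le_rsqrt)
        then show "0 \<le> r n" by (smt (verit) divide_nonneg_nonneg of_nat_0_le_iff)
      qed
      have "\<bar>K n \<omega> x - H x\<bar> \<le> 5 * r n" if x: "x \<le> u" for x
      proof -
        obtain p where p: "p \<in> G n" "x \<le> p" "H p \<le> H x + 1 / n" using G(3)[OF n x] by blast
        have "K n \<omega> x \<le> K n \<omega> p" using monoK p(2) by (simp add: mono_def)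
        then have up: "K n \<omega> x - H x \<le> 5 * r n" using close[OF p(1)] p(3) rn by linarith
        have "H x - K n \<omega> x \<le> 5 * r n"
        proof (cases "H x \<le> 1 / n")
          case True
          then show ?thesis using K0[of n \<omega> x] rn by linarith
        next
          case False
          then obtain q where q: "q \<in> G n" "q \<le> x" "H x \<le> H q + 1 / n" using G(4)[OF n x] by blast
          have "K n \<omega> q \<le> K n \<omega> x" using monoK q(2) by (simp add: mono_def)
          then show ?thesis using close[OF q(1)] q(3) rn by linarith
        qed
        with up show ?thesis by linarith
      qed
      then show ?case by (simp add: r_def)
    qed
  qed
qed

section \<open>Uniform rates under random censorship\<close>

text \<open>
  The random censorship model of the theorem, with the two marginal laws in place of their
  distribution functions and the densities reduced to the absence of atoms.
\<close>

locale na_censoring = prob_space M for M :: "'a measure" +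
  fixes T Y :: "nat \<Rightarrow> 'a \<Rightarrow> real" and P Q :: "real measure"
  assumes T_measurable: "\<And>i. 1 \<le> i \<Longrightarrow> T i \<in> borel_measurable M"
    and Y_measurable: "\<And>i. 1 \<le> i \<Longrightarrow> Y i \<in> borel_measurable M"
    and neg_assoc_T: "neg_assoc_seq M T" and neg_assoc_Y: "neg_assoc_seq M Y"
    and indep: "indep_var (Pi\<^sub>M {1..} (\<lambda>_. borel)) (\<lambda>\<omega>. \<lambda>i\<in>{1..}. T i \<omega>)
        (Pi\<^sub>M {1..} (\<lambda>_. borel)) (\<lambda>\<omega>. \<lambda>i\<in>{1..}. Y i \<omega>)"
    and law_T: "\<And>i. 1 \<le> i \<Longrightarrow> distr M borel (T i) = P"
    and law_Y: "\<And>i. 1 \<le> i \<Longrightarrow> distr M borel (Y i) = Q"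
    and atomless_P: "\<And>x. measure P {x} = 0" and atomless_Q: "\<And>x. measure Q {x} = 0"
begin

text \<open>
  The law of \<open>T\<close> on the event \<open>T \<le> Y\<close>, a measure of total mass at most 1. As \<open>Q\<close> has no atoms,
  \<open>1 - cdf Q t\<close> is the probability of \<open>t \<le> Y\<close>.
\<close>

definition sub_law :: "real measure" where
  "sub_law = density P (\<lambda>t. ennreal (1 - cdf Q t))"

sublocale P: real_distribution P
  using real_distribution_distr[OF T_measurable[of 1]] law_T[of 1] by simp

sublocale Q: real_distribution Q
  using real_distribution_distr[OF Y_measurable[of 1]] law_Y[of 1] by simp

lemma measurable_cdf_Q [measurable]: "cdf Q \<in> borel_measurable borel"
  by (intro borel_measurable_mono monoI Q.cdf_nondecreasing)

lemma measurable_cdf_P [measurable]: "cdf P \<in> borel_measurable borel"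
  by (intro borel_measurable_mono monoI P.cdf_nondecreasing)

lemma sets_sub_law [simp, measurable_cong]: "sets sub_law = sets borel"
  by (simp add: sub_law_def)

lemma integral_sub_law:
  assumes [measurable]: "h \<in> borel_measurable borel"
  shows "integral\<^sup>L sub_law h = (\<integral>t. (1 - cdf Q t) * h t \<partial>P)"
  unfolding sub_law_def using Q.cdf_bounded_prob
  by (subst integral_density) auto

lemma finite_borel_measure_sub_law: "finite_borel_measure sub_law"
proof -
  have "emeasure sub_law (space sub_law) = (\<integral>\<^sup>+t. ennreal (1 - cdf Q t) \<partial>P)"
    unfolding sub_law_def by (subst emeasure_density) auto
  also have "\<dots> \<le> (\<integral>\<^sup>+t. 1 \<partial>P)"
    using Q.cdf_nonneg by (intro nn_integral_mono) (simp add: ennreal_le_1)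
  also have "\<dots> = 1" by (simp add: P.emeasure_space_1[simplified])
  finally have "finite_measure sub_law" by (intro finite_measureI) (auto simp: top_unique)
  then show ?thesis by (simp add: finite_borel_measure_def finite_borel_measure_axioms_def)
qed

sublocale sub_law: finite_borel_measure sub_law by (rule finite_borel_measure_sub_law)

lemma atomless_sub_law: "measure sub_law {x} = 0"
proof -
  have "measure sub_law {x} = (\<integral>t. indicator {x} t \<partial>sub_law)" by (simp add: sub_law.borel_UNIV)
  also have "\<dots> = (\<integral>t. (1 - cdf Q t) * indicator {x} t \<partial>P)" by (rule integral_sub_law) simp
  also have "\<dots> = (\<integral>t. (1 - cdf Q x) * indicator {x} t \<partial>P)"
    by (intro Bochner_Integration.integral_cong) (auto simp: indicator_def)
  also have "\<dots> = 0" by (simp add: atomless_P)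
  finally show ?thesis .
qed

lemma integral_uncensored:
  fixes h :: "real \<Rightarrow> real"
  assumes h [measurable]: "h \<in> borel_measurable borel" and bnd: "\<And>x. \<bar>h x\<bar> \<le> K"
  shows "(\<integral>y. \<integral>t. of_bool (t \<le> y) * h t \<partial>P \<partial>Q) = integral\<^sup>L sub_law h"
    and "1 \<le> i \<Longrightarrow> expectation (\<lambda>\<omega>. of_bool (T i \<omega> \<le> Y i \<omega>) * h (T i \<omega>)) = integral\<^sup>L sub_law h"
proof -
  interpret PQ: pair_prob_space P Q ..
  let ?f = "\<lambda>t y. of_bool (t \<le> y) * h t"
  have fm [measurable]: "(\<lambda>(t, y). ?f t y) \<in> borel_measurable (borel \<Otimes>\<^sub>M borel)"
    by measurable
  have int: "integrable (P \<Otimes>\<^sub>M Q) (\<lambda>(t, y). ?f t y)"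
  proof (rule PQ.integrable_const_bound[of _ "\<bar>K\<bar>"])
    show "AE z in P \<Otimes>\<^sub>M Q. norm (case z of (t, y) \<Rightarrow> ?f t y) \<le> \<bar>K\<bar>"
      using bnd by (intro AE_I2) (auto split: prod.split simp: of_bool_def intro: order_trans[OF bnd])
    show "(\<lambda>(t, y). ?f t y) \<in> borel_measurable (P \<Otimes>\<^sub>M Q)"
      using fm by (simp cong: measurable_cong_sets sets_pair_measure_cong)
  qed
  have inner: "(\<integral>y. ?f t y \<partial>Q) = (1 - cdf Q t) * h t" for t
  proof -
    have "(\<integral>y. of_bool (t \<le> y) \<partial>Q) = (\<integral>y. indicator {t..} y \<partial>Q :: real)"
      by (intro Bochner_Integration.integral_cong) (auto simp: indicator_def)
    also have "\<dots> = 1 - cdf Q t"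
      using measure_atLeast_atomless[OF Q.real_distribution_axioms atomless_Q] by simp
    finally show ?thesis by simp
  qed
  have joint: "integral\<^sup>L (P \<Otimes>\<^sub>M Q) (\<lambda>(t, y). ?f t y) = integral\<^sup>L sub_law h"
    using PQ.integral_fst[OF int] unfolding inner by (simp add: integral_sub_law)
  show "(\<integral>y. \<integral>t. of_bool (t \<le> y) * h t \<partial>P \<partial>Q) = integral\<^sup>L sub_law h"
    using PQ.integral_snd[OF int] joint by simp
  show "expectation (\<lambda>\<omega>. of_bool (T i \<omega> \<le> Y i \<omega>) * h (T i \<omega>)) = integral\<^sup>L sub_law h" if i: "1 \<le> i"
  proof -
    have "(\<lambda>x. x i) \<in> measurable (Pi\<^sub>M {1..} (\<lambda>_. borel)) (borel :: real measure)"
      using i by (intro measurable_component_singleton) simp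
    from indep_var_compose[OF indep this this] have "indep_var borel (T i) borel (Y i)"
      using i by (simp add: comp_def)
    then have "P \<Otimes>\<^sub>M Q = distr M (borel \<Otimes>\<^sub>M borel) (\<lambda>\<omega>. (T i \<omega>, Y i \<omega>))"
      unfolding indep_var_distribution_eq law_T[OF i] law_Y[OF i] by blast
    then have "integral\<^sup>L (P \<Otimes>\<^sub>M Q) (\<lambda>(t, y). ?f t y) =
        expectation (\<lambda>\<omega>. case (T i \<omega>, Y i \<omega>) of (t, y) \<Rightarrow> ?f t y)"
      using integral_distr[OF measurable_Pair[OF T_measurable[OF i] Y_measurable[OF i]] fm] by simp
    then show ?thesis using joint by simp
  qed
qed

lemma cdf_sub_law: "cdf sub_law x = (\<integral>y. \<integral>t. of_bool (t \<le> x \<and> t \<le> y) \<partial>P \<partial>Q)"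
proof -
  have "cdf sub_law x = (\<integral>t. indicator {..x} t \<partial>sub_law)"
    by (simp add: cdf_def sub_law.borel_UNIV)
  also have "\<dots> = (\<integral>y. \<integral>t. of_bool (t \<le> y) * indicator {..x} t \<partial>P \<partial>Q)"
    by (rule integral_uncensored(1)[symmetric, of _ 1]) (auto simp: indicator_def)
  also have "\<dots> = (\<integral>y. \<integral>t. of_bool (t \<le> x \<and> t \<le> y) \<partial>P \<partial>Q)"
    by (intro Bochner_Integration.integral_cong) (auto simp: indicator_def)
  finally show ?thesis .
qed

text \<open>
  The censoring factor of the density of \<open>sub_law\<close> cancels against that of the probability of being
  at risk. This is why the product-limit estimator, built from censored data only, estimates the
  uncensored law.
\<close>

lemma hazard_sub_law:
  assumes "cdf P x < 1" "cdf Q x < 1"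
  shows "(LINT y:{..x}|sub_law. 1 / ((1 - cdf P y) * (1 - cdf Q y))) = - ln (1 - cdf P x)"
proof -
  have "(LINT y:{..x}|sub_law. 1 / ((1 - cdf P y) * (1 - cdf Q y))) =
      (\<integral>y. (1 - cdf Q y) * (indicator {..x} y * (1 / ((1 - cdf P y) * (1 - cdf Q y)))) \<partial>P)"
    unfolding set_lebesgue_integral_def by (subst integral_sub_law) auto
  also have "\<dots> = (LINT y:{..x}|P. 1 / (1 - cdf P y))"
    unfolding set_lebesgue_integral_def
  proof (intro Bochner_Integration.integral_cong refl)
    fix y
    have "cdf Q y < 1" if "y \<le> x" using Q.cdf_nondecreasing[OF that] assms(2) by linarith
    then show "(1 - cdf Q y) * (indicator {..x} y * (1 / ((1 - cdf P y) * (1 - cdf Q y)))) =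
        indicator {..x} y *\<^sub>R (1 / (1 - cdf P y))"
      by (cases "y \<le> x") auto
  qed
  also have "\<dots> = - ln (1 - cdf P x)"
    by (rule cumulative_hazard_continuous_cdf[OF P.real_distribution_axioms _ assms(1)])
      (simp add: P.isCont_cdf atomless_P)
  finally show ?thesis .
qed

lemma measurable_of_bool_events:
  "i \<in> {1..n} \<Longrightarrow> (\<lambda>\<omega>. of_bool (T i \<omega> \<le> x \<and> T i \<omega> \<le> Y i \<omega>) :: real) \<in> borel_measurable M"
  "i \<in> {1..n} \<Longrightarrow> (\<lambda>\<omega>. of_bool (x \<le> T i \<omega> \<and> x \<le> Y i \<omega>) :: real) \<in> borel_measurable M"
proof -
  assume i: "i \<in> {1..n}"
  have [measurable]: "T i \<in> borel_measurable M" "Y i \<in> borel_measurable M"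
    using i T_measurable Y_measurable by auto
  show "(\<lambda>\<omega>. of_bool (T i \<omega> \<le> x \<and> T i \<omega> \<le> Y i \<omega>) :: real) \<in> borel_measurable M"
    "(\<lambda>\<omega>. of_bool (x \<le> T i \<omega> \<and> x \<le> Y i \<omega>) :: real) \<in> borel_measurable M"
    by measurable
qed

lemma neg_assoc_families: "neg_assoc_family M {1..n} T" "neg_assoc_family M {1..n} Y"
  using neg_assoc_T neg_assoc_Y by (auto simp: neg_assoc_seq_def)

text \<open>
  The indicator of \<open>t \<le> x, t \<le> y\<close> is decreasing in \<open>t\<close>, and its mean over \<open>t\<close> increases with
  \<open>y\<close>.
\<close>

lemma sub_empirical_uniform_rate:
  "AE \<omega> in M. \<forall>\<^sub>F n in sequentially. \<forall>x\<le>u.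
     \<bar>sub_empirical T Y n \<omega> x - cdf sub_law x\<bar> \<le> 5 * sqrt (ln (real n) / real n)"
proof (rule uniform_rate_of_pointwise_tails)
  show "mono (cdf sub_law)" by (intro monoI sub_law.cdf_nondecreasing)
  show "continuous_on UNIV (cdf sub_law)"
    by (simp add: continuous_on_eq_continuous_at sub_law.isCont_cdf atomless_sub_law)
  show "(cdf sub_law \<longlongrightarrow> 0) at_bot" by (rule sub_law.cdf_lim_at_bot)
  show "cdf sub_law x \<le> 1" for x
  proof -
    have "cdf sub_law x \<le> (\<integral>t. 1 \<partial>sub_law)" using sub_law.cdf_bounded[of x] by simp
    also have "\<dots> = (\<integral>t. (1 - cdf Q t) * 1 \<partial>P)" by (rule integral_sub_law) simp
    also have "\<dots> \<le> (\<integral>t. 1 \<partial>P)"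
      using Q.cdf_nonneg Q.cdf_bounded_prob
      by (intro integral_mono P.integrable_const_bound[of _ 1]) auto
    finally show ?thesis by (simp add: P.prob_space[simplified])
  qed
  fix n :: nat
  show "mono (sub_empirical T Y n \<omega>)" for \<omega>
    unfolding sub_empirical_def by (intro monoI divide_right_mono sum_mono) auto
  show "0 \<le> sub_empirical T Y n \<omega> x" for \<omega> x
    unfolding sub_empirical_def by (intro divide_nonneg_nonneg sum_nonneg) auto
  fix x
  show "(\<lambda>\<omega>. sub_empirical T Y n \<omega> x) \<in> borel_measurable M"
    unfolding sub_empirical_def uncensored_event_iff
    by (intro borel_measurable_divide borel_measurable_sum borel_measurable_const measurable_of_bool_events)
  fix e :: real assume n: "1 \<le> n" and e: "0 < e"
  let ?\<phi> = "\<lambda>t y. of_bool (t \<le> x \<and> t \<le> y) :: real"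
  have "prob {\<omega>\<in>space M. 2 * (n * e) \<le> \<bar>\<Sum>i=1..n. ?\<phi> (T i \<omega>) (Y i \<omega>) - (\<integral>y. \<integral>t. ?\<phi> t y \<partial>P \<partial>Q)\<bar>}
    \<le> 4 * exp (- 2 * real n * e\<^sup>2)"
  proof (rule neg_assoc_pair_hoeffding[OF neg_assoc_families T_measurable Y_measurable indep law_T law_Y])
    show "(\<lambda>(t, y). ?\<phi> t y) \<in> borel_measurable (borel \<Otimes>\<^sub>M borel)" by measurable
    show "(\<forall>y. mono (\<lambda>t. ?\<phi> t y)) \<or> (\<forall>y. antimono (\<lambda>t. ?\<phi> t y))"
      by (intro disjI2 allI antimonoI) auto
    have "mono (\<lambda>y. \<integral>t. ?\<phi> t y \<partial>P)"
      by (intro monoI integral_mono P.integrable_const_bound[of _ 1]) (auto cong: measurable_cong_sets)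
    then show "mono (\<lambda>y. \<integral>t. ?\<phi> t y \<partial>P) \<or> antimono (\<lambda>y. \<integral>t. ?\<phi> t y \<partial>P)" ..
  qed (use e in auto)
  moreover have "(2 * e \<le> \<bar>sub_empirical T Y n \<omega> x - cdf sub_law x\<bar>) \<longleftrightarrow>
      2 * (n * e) \<le> \<bar>\<Sum>i=1..n. ?\<phi> (T i \<omega>) (Y i \<omega>) - (\<integral>y. \<integral>t. ?\<phi> t y \<partial>P \<partial>Q)\<bar>" for \<omega>
  proof -
    have "n * (sub_empirical T Y n \<omega> x - cdf sub_law x) =
        (\<Sum>i=1..n. ?\<phi> (T i \<omega>) (Y i \<omega>) - (\<integral>y. \<integral>t. ?\<phi> t y \<partial>P \<partial>Q))"
      using n unfolding sum_subtractf sub_empirical_def uncensored_event_iff cdf_sub_law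
      by (simp add: right_diff_distrib del: sum_of_bool_eq)
    then have "\<bar>\<Sum>i=1..n. ?\<phi> (T i \<omega>) (Y i \<omega>) - (\<integral>y. \<integral>t. ?\<phi> t y \<partial>P \<partial>Q)\<bar> =
        n * \<bar>sub_empirical T Y n \<omega> x - cdf sub_law x\<bar>"
      by (metis abs_mult abs_of_nat)
    moreover have "2 * (n * e) \<le> n * a \<longleftrightarrow> 2 * e \<le> a" for a :: real
      using n mult_le_cancel_left_pos[of "real n" "2 * e" a] by (simp add: mult.left_commute)
    ultimately show ?thesis by simp
  qed
  ultimately show "prob {\<omega>\<in>space M. 2 * e \<le> \<bar>sub_empirical T Y n \<omega> x - cdf sub_law x\<bar>}
      \<le> 4 * exp (- 2 * real n * e\<^sup>2)" by simp
qed

definition at_risk_prob :: "real \<Rightarrow> real" where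
  "at_risk_prob x = (1 - cdf P x) * (1 - cdf Q x)"

lemma antimono_risk: "antimono at_risk_prob"
  unfolding at_risk_prob_def[abs_def]
  by (intro antimonoI mult_mono diff_left_mono P.cdf_nondecreasing Q.cdf_nondecreasing)
    (simp_all add: P.cdf_bounded_prob Q.cdf_bounded_prob)

lemma integral_at_risk: "(\<integral>y. \<integral>t. of_bool (x \<le> t \<and> x \<le> y) \<partial>P \<partial>Q) = at_risk_prob x"
proof -
  have eq: "of_bool (x \<le> t \<and> x \<le> y) = indicator {x..} t * (indicator {x..} y :: real)" for t y
    by (auto simp: indicator_def)
  show ?thesis
    using measure_atLeast_atomless[OF P.real_distribution_axioms atomless_P] measure_atLeast_atomless[OF Q.real_distribution_axioms atomless_Q]
    by (simp add: eq at_risk_prob_def)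
qed

lemma num_at_risk_eq_sum:
  "real (num_at_risk T Y n \<omega> x) = (\<Sum>i=1..n. of_bool (x \<le> T i \<omega> \<and> x \<le> Y i \<omega>))"
  by (simp add: num_at_risk_def sum_of_bool_eq Int_def Collect_conj_eq[symmetric] obs_time_def)

text \<open>
  The indicator of \<open>x \<le> t, x \<le> y\<close> is increasing in both variables; the complementary proportion is
  the increasing process to which the uniform bound applies.
\<close>

lemma at_risk_uniform_rate:
  "AE \<omega> in M. \<forall>\<^sub>F n in sequentially. \<forall>x\<le>u.
     \<bar>real (num_at_risk T Y n \<omega> x) / real n - at_risk_prob x\<bar> \<le> 5 * sqrt (ln (real n) / real n)"
proof -
  let ?K = "\<lambda>n \<omega> x. 1 - real (num_at_risk T Y n \<omega> x) / real n"
  have "AE \<omega> in M. \<forall>\<^sub>F n in sequentially. \<forall>x\<le>u.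
     \<bar>?K n \<omega> x - (1 - at_risk_prob x)\<bar> \<le> 5 * sqrt (ln (real n) / real n)"
  proof (rule uniform_rate_of_pointwise_tails)
    show "mono (\<lambda>x. 1 - at_risk_prob x)" using antimono_risk by (auto simp: monotone_def)
    show "continuous_on UNIV (\<lambda>x. 1 - at_risk_prob x)"
      unfolding at_risk_prob_def using P.isCont_cdf Q.isCont_cdf
      by (intro continuous_intros) (auto simp: continuous_on_eq_continuous_at atomless_P atomless_Q)
    have "((\<lambda>x. 1 - at_risk_prob x) \<longlongrightarrow> 1 - (1 - 0) * (1 - 0)) at_bot"
      unfolding at_risk_prob_def by (intro tendsto_intros P.cdf_lim_at_bot Q.cdf_lim_at_bot)
    then show "((\<lambda>x. 1 - at_risk_prob x) \<longlongrightarrow> 0) at_bot" by simp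
    show "1 - at_risk_prob x \<le> 1" for x by (simp add: at_risk_prob_def P.cdf_bounded_prob Q.cdf_bounded_prob)
    fix n :: nat
    show "mono (?K n \<omega>)" for \<omega>
      unfolding num_at_risk_eq_sum by (intro monoI diff_left_mono divide_right_mono sum_mono) auto
    show "0 \<le> ?K n \<omega> x" for \<omega> x
    proof -
      have "real (num_at_risk T Y n \<omega> x) \<le> (\<Sum>i=1..n. 1)"
        unfolding num_at_risk_eq_sum by (intro sum_mono) auto
      then show ?thesis by (cases "n = 0") (simp_all add: divide_le_eq_1)
    qed
    fix x
    show "(\<lambda>\<omega>. ?K n \<omega> x) \<in> borel_measurable M"
      unfolding num_at_risk_eq_sum
      by (intro borel_measurable_diff borel_measurable_divide borel_measurable_sum borel_measurable_const
          measurable_of_bool_events)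
    fix e :: real assume n: "1 \<le> n" and e: "0 < e"
    let ?\<phi> = "\<lambda>t y. of_bool (x \<le> t \<and> x \<le> y) :: real"
    have "prob {\<omega>\<in>space M. 2 * (n * e) \<le> \<bar>\<Sum>i=1..n. ?\<phi> (T i \<omega>) (Y i \<omega>) - (\<integral>y. \<integral>t. ?\<phi> t y \<partial>P \<partial>Q)\<bar>}
      \<le> 4 * exp (- 2 * real n * e\<^sup>2)"
    proof (rule neg_assoc_pair_hoeffding[OF neg_assoc_families T_measurable Y_measurable indep law_T law_Y])
      show "(\<lambda>(t, y). ?\<phi> t y) \<in> borel_measurable (borel \<Otimes>\<^sub>M borel)" by measurable
      show "(\<forall>y. mono (\<lambda>t. ?\<phi> t y)) \<or> (\<forall>y. antimono (\<lambda>t. ?\<phi> t y))"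
        by (intro disjI1 allI monoI) auto
      have "mono (\<lambda>y. \<integral>t. ?\<phi> t y \<partial>P)"
        by (intro monoI integral_mono P.integrable_const_bound[of _ 1]) (auto cong: measurable_cong_sets)
      then show "mono (\<lambda>y. \<integral>t. ?\<phi> t y \<partial>P) \<or> antimono (\<lambda>y. \<integral>t. ?\<phi> t y \<partial>P)" ..
    qed (use e in auto)
    moreover have "(2 * e \<le> \<bar>?K n \<omega> x - (1 - at_risk_prob x)\<bar>) \<longleftrightarrow>
        2 * (n * e) \<le> \<bar>\<Sum>i=1..n. ?\<phi> (T i \<omega>) (Y i \<omega>) - (\<integral>y. \<integral>t. ?\<phi> t y \<partial>P \<partial>Q)\<bar>" for \<omega>
    proof -
      have "- (n * (?K n \<omega> x - (1 - at_risk_prob x))) =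
          (\<Sum>i=1..n. ?\<phi> (T i \<omega>) (Y i \<omega>) - (\<integral>y. \<integral>t. ?\<phi> t y \<partial>P \<partial>Q))"
        using n unfolding sum_subtractf integral_at_risk
        by (simp add: num_at_risk_eq_sum right_diff_distrib del: sum_of_bool_eq)
      then have "\<bar>\<Sum>i=1..n. ?\<phi> (T i \<omega>) (Y i \<omega>) - (\<integral>y. \<integral>t. ?\<phi> t y \<partial>P \<partial>Q)\<bar> =
          n * \<bar>?K n \<omega> x - (1 - at_risk_prob x)\<bar>"
        by (metis abs_minus_cancel abs_mult abs_of_nat)
      moreover have "2 * (n * e) \<le> n * a \<longleftrightarrow> 2 * e \<le> a" for a :: real
        using n mult_le_cancel_left_pos[of "real n" "2 * e" a] by (simp add: mult.left_commute)
      ultimately show ?thesis by simp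
    qed
    ultimately show "prob {\<omega>\<in>space M. 2 * e \<le> \<bar>?K n \<omega> x - (1 - at_risk_prob x)\<bar>}
        \<le> 4 * exp (- 2 * real n * e\<^sup>2)" by simp
  qed
  then show ?thesis by (simp add: abs_minus_commute)
qed

lemma kaplan_meier_uniform_rate:
  assumes "cdf P u < 1" "cdf Q u < 1"
  obtains C where "0 \<le> C" "AE \<omega> in M. \<forall>\<^sub>F n in sequentially. \<forall>x\<le>u.
     \<bar>kaplan_meier T Y n \<omega> x - cdf P x\<bar> \<le> C * sqrt (ln (real n) / real n)"
proof -
  define c where "c = at_risk_prob u"
  define r where "r n = sqrt (ln (real n) / real n)" for n :: nat
  have c: "0 < c" using assms by (simp add: c_def at_risk_prob_def)
  have r0: "r \<longlonglongrightarrow> 0"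
    unfolding r_def by real_asymp
  show thesis
  proof
    show "0 \<le> (18 / c\<^sup>2 + 2 / c) * 5" using c by simp
    show "AE \<omega> in M. \<forall>\<^sub>F n in sequentially. \<forall>x\<le>u.
        \<bar>kaplan_meier T Y n \<omega> x - cdf P x\<bar> \<le> (18 / c\<^sup>2 + 2 / c) * 5 * sqrt (ln (real n) / real n)"
      using sub_empirical_uniform_rate[of u] at_risk_uniform_rate[of u]
    proof eventually_elim
      case (elim \<omega>)
      \<comment> \<open>The uniform distance \<open>5 * r n\<close> has to drop below \<open>c / 8\<close>.\<close>
      have "\<forall>\<^sub>F n in sequentially. r n < c / 40"
        using c by (intro order_tendstoD(2)[OF r0]) simp
      moreover have "\<forall>\<^sub>F n in sequentially. 1 \<le> n" by (rule eventually_ge_at_top)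
      ultimately show ?case using elim
      proof eventually_elim
        case (elim n)
        show ?case
        proof (intro allI impI)
          fix x assume x: "x \<le> u"
          have "\<bar>kaplan_meier T Y n \<omega> x - (1 - (1 - cdf P x))\<bar> \<le> (18 / c\<^sup>2 + 2 / c) * (5 * r n)"
          proof (rule kaplan_meier_discrepancy[where B = at_risk_prob and \<nu> = sub_law and S = "\<lambda>x. 1 - cdf P x" and u = u])
            show "antimono_on {..u} at_risk_prob" using antimono_risk by (auto simp: monotone_def monotone_on_def)
            show "c \<le> at_risk_prob t" if "t \<le> u" for t
              using antimono_risk that by (auto simp: monotone_def c_def)
            have "cdf P x < 1" "cdf Q x < 1"
              using P.cdf_nondecreasing[OF x] Q.cdf_nondecreasing[OF x] assms by linarith+
            then show "(LINT y:{..x}|sub_law. 1 / at_risk_prob y) = - ln (1 - cdf P x)" "0 < 1 - cdf P x"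
              unfolding at_risk_prob_def using hazard_sub_law by auto
          qed (use elim x c atomless_sub_law sub_law.finite_borel_measure_axioms in \<open>auto simp: r_def P.cdf_nonneg\<close>)
          then show "\<bar>kaplan_meier T Y n \<omega> x - cdf P x\<bar> \<le> (18 / c\<^sup>2 + 2 / c) * 5 * sqrt (ln (real n) / real n)"
            by (simp only: r_def mult.assoc diff_diff_eq2 add_diff_cancel_left')
        qed
      qed
    qed
  qed
qed

lemma expectation_kernel_smooth_sub_empirical:
  assumes k: "k \<in> borel_measurable borel" "\<And>x. \<bar>k x\<bar> \<le> K" and n: "1 \<le> n"
  shows "expectation (\<lambda>\<omega>. kernel_smooth k b a (sub_empirical T Y n \<omega>) t) =
    inverse b * (LINT x:{x. a \<le> ereal x}|sub_law. k ((t - x) / b))"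
proof -
  define h where "h x = indicator {x. a \<le> ereal x} x * k ((t - x) / b)" for x
  have hm: "h \<in> borel_measurable borel"
    unfolding h_def using measurable_compose[OF _ k(1), of "\<lambda>x. (t - x) / b" borel]
    by (intro borel_measurable_times borel_measurable_indicator) auto
  have hb: "\<bar>h x\<bar> \<le> K" for x
    using k(2)[of "(t - x) / b"] by (auto simp: h_def indicator_def)
  have int: "integrable M (\<lambda>\<omega>. of_bool (T i \<omega> \<le> Y i \<omega>) * h (T i \<omega>))" if "i \<in> {1..n}" for i
  proof (rule integrable_const_bound[of _ K])
    show "AE \<omega> in M. norm (of_bool (T i \<omega> \<le> Y i \<omega>) * h (T i \<omega>)) \<le> K"
      using hb order_trans[OF abs_ge_zero hb] by (intro AE_I2) (simp add: of_bool_def)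
    have [measurable]: "T i \<in> borel_measurable M" "Y i \<in> borel_measurable M"
      using that T_measurable Y_measurable by auto
    note [measurable] = hm
    show "(\<lambda>\<omega>. of_bool (T i \<omega> \<le> Y i \<omega>) * h (T i \<omega>)) \<in> borel_measurable M" by measurable
  qed
  have "kernel_smooth k b a (sub_empirical T Y n \<omega>) t =
      inverse b * ((\<Sum>i=1..n. of_bool (T i \<omega> \<le> Y i \<omega>) * h (T i \<omega>)) / n)" for \<omega>
    using integral_event_measure[OF hm, of T Y n \<omega>]
    unfolding kernel_smooth_def interval_measure_sub_empirical
    by (simp only: set_lebesgue_integral_def real_scaleR_def h_def[abs_def])
  then have "expectation (\<lambda>\<omega>. kernel_smooth k b a (sub_empirical T Y n \<omega>) t) =
      expectation (\<lambda>\<omega>. inverse b * ((\<Sum>i=1..n. of_bool (T i \<omega> \<le> Y i \<omega>) * h (T i \<omega>)) / n))"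
    by (simp only:)
  also have "\<dots> = inverse b * ((\<Sum>i=1..n. expectation (\<lambda>\<omega>. of_bool (T i \<omega> \<le> Y i \<omega>) * h (T i \<omega>))) / n)"
  proof -
    have "expectation (\<lambda>\<omega>. \<Sum>i=1..n. of_bool (T i \<omega> \<le> Y i \<omega>) * h (T i \<omega>)) =
        (\<Sum>i=1..n. expectation (\<lambda>\<omega>. of_bool (T i \<omega> \<le> Y i \<omega>) * h (T i \<omega>)))"
      by (rule Bochner_Integration.integral_sum) (rule int)
    then show ?thesis by (simp only: integral_mult_right_zero integral_divide_zero)
  qed
  also have "(\<Sum>i=1..n. expectation (\<lambda>\<omega>. of_bool (T i \<omega> \<le> Y i \<omega>) * h (T i \<omega>))) =
      (\<Sum>i=1..n. integral\<^sup>L sub_law h)"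
    by (intro sum.cong refl integral_uncensored(2)[OF hm hb]) simp
  also have "\<dots> / n = integral\<^sup>L sub_law h" using n by simp
  finally show ?thesis by (simp only: set_lebesgue_integral_def real_scaleR_def h_def[abs_def])
qed

section \<open>Rates for the kernel estimators\<close>

text \<open>
  Both terms are integrals of the kernel against differences of measures, whose distribution functions
  are close on \<open>{..u}\<close>; the factor \<open>inverse (b n)\<close> is that of the smoothing. The divisor
  \<open>1 - cdf Q t\<close> stays above \<open>1 - cdf Q u\<close>.
\<close>

lemma kernel_estimator_rate:
  fixes k :: "real \<Rightarrow> real" and b :: "nat \<Rightarrow> real" and \<tau> u r s :: real and a :: ereal
  assumes k: "k \<in> borel_measurable borel" and bv: "bounded_variation_on {r<..<s} k"
    and r: "r < 0" and s: "0 < s" and supp: "\<And>x. x \<notin> {r<..<s} \<Longrightarrow> k x = 0"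
    and u: "\<tau> < u" "cdf P u < 1" "cdf Q u < 1"
    and b: "\<And>n. 1 \<le> n \<Longrightarrow> 0 < b n" "b \<longlonglongrightarrow> 0"
  obtains C where "AE \<omega> in M. \<forall>\<^sub>F n in sequentially. \<forall>t\<le>\<tau>.
    \<bar>kernel_smooth k (b n) a (kaplan_meier T Y n \<omega>) t - kernel_smooth k (b n) a (cdf P) t
      - (kernel_smooth k (b n) a (sub_empirical T Y n \<omega>) t
          - expectation (\<lambda>\<omega>. kernel_smooth k (b n) a (sub_empirical T Y n \<omega>) t)) / (1 - cdf Q t)\<bar>
    \<le> C * (inverse (b n) * sqrt (ln (real n) / real n))"
proof -
  have "r < s" using r s by simp
  define rate where "rate n = sqrt (ln (real n) / real n)" for n :: nat
  let ?A = "{x. a \<le> ereal x}"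
  have A: "is_interval ?A"
    unfolding is_interval_1 by (auto intro: order_trans)
  obtain Ck where Ck: "0 \<le> Ck"
    "\<forall>\<mu> \<nu> (u :: real) e (A :: real set) b t.
      finite_borel_measure \<mu> \<longrightarrow> finite_borel_measure \<nu> \<longrightarrow>
      (\<forall>x\<le>u. \<bar>cdf \<mu> x - cdf \<nu> x\<bar> \<le> e) \<longrightarrow> is_interval A \<longrightarrow> 0 < b \<longrightarrow> t - r * b \<le> u \<longrightarrow>
      \<bar>(LINT x:A|\<mu>. k ((t - x) / b)) - (LINT x:A|\<nu>. k ((t - x) / b))\<bar> \<le> Ck * e"
    using kernel_integral_discrepancy[OF bv \<open>r < s\<close> supp] by blast
  obtain K where K: "\<forall>x. \<bar>k x\<bar> \<le> K"
    using bounded_variation_imp_bounded[OF bv \<open>r < s\<close> supp] by blast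
  obtain Ckm where Ckm: "0 \<le> Ckm" "AE \<omega> in M. \<forall>\<^sub>F n in sequentially. \<forall>x\<le>u.
      \<bar>kaplan_meier T Y n \<omega> x - cdf P x\<bar> \<le> Ckm * sqrt (ln (real n) / real n)"
    by (rule kaplan_meier_uniform_rate[OF u(2,3)])
  define g where "g = 1 - cdf Q u"
  have g: "0 < g" using u by (simp add: g_def)
  \<comment> \<open>As \<open>r\<close> is negative, this means \<open>\<tau> - r * b n < u\<close>.\<close>
  have b_ev: "\<forall>\<^sub>F n in sequentially. b n < (u - \<tau>) / (- r)"
    using u r by (intro order_tendstoD(2)[OF b(2)]) (simp add: divide_pos_neg)
  show thesis
  proof
    show "AE \<omega> in M. \<forall>\<^sub>F n in sequentially. \<forall>t\<le>\<tau>.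
      \<bar>kernel_smooth k (b n) a (kaplan_meier T Y n \<omega>) t - kernel_smooth k (b n) a (cdf P) t
        - (kernel_smooth k (b n) a (sub_empirical T Y n \<omega>) t
            - expectation (\<lambda>\<omega>. kernel_smooth k (b n) a (sub_empirical T Y n \<omega>) t)) / (1 - cdf Q t)\<bar>
      \<le> (Ck * Ckm + Ck * 5 / g) * (inverse (b n) * sqrt (ln (real n) / real n))"
      using Ckm(2) sub_empirical_uniform_rate[of u]
    proof eventually_elim
      case (elim \<omega>)
      have "\<forall>\<^sub>F n in sequentially. 1 \<le> n" by (rule eventually_ge_at_top)
      then show ?case using b_ev elim
      proof eventually_elim
        case (elim n)
        have bn: "0 < b n" using b(1) elim by simp
        have e0: "0 \<le> rate n" using elim by (simp add: rate_def)
        have km: "\<bar>kaplan_meier T Y n \<omega> x - cdf P x\<bar> \<le> Ckm * rate n"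
          and se: "\<bar>sub_empirical T Y n \<omega> x - cdf sub_law x\<bar> \<le> 5 * rate n" if "x \<le> u" for x
          using elim that by (auto simp: rate_def)
        show ?case
        proof (intro allI impI)
          fix t assume t: "t \<le> \<tau>"
          have "b n < (u - \<tau>) / (- r)" using elim by blast
          then have "b n * (- r) < u - \<tau>" using r by (simp only: pos_less_divide_eq neg_0_less_iff_less)
          then have tu: "t - r * b n \<le> u" using t by (simp add: mult.commute)
          let ?I = "\<lambda>\<mu>. LINT x:?A|\<mu>. k ((t - x) / b n)"
          have "\<bar>?I (interval_measure (kaplan_meier T Y n \<omega>)) - ?I P\<bar> \<le> Ck * (Ckm * rate n)"
            by (rule Ck(2)[rule_format, OF finite_borel_measure_kaplan_meier P.finite_borel_measure_M _ A bn tu])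
              (simp add: cdf_kaplan_meier km)
          moreover have "kernel_smooth k (b n) a (kaplan_meier T Y n \<omega>) t - kernel_smooth k (b n) a (cdf P) t
              = inverse (b n) * (?I (interval_measure (kaplan_meier T Y n \<omega>)) - ?I P)"
            unfolding kernel_smooth_def interval_measure_cdf[OF P.finite_borel_measure_M]
            by (simp only: right_diff_distrib)
          ultimately have first: "\<bar>kernel_smooth k (b n) a (kaplan_meier T Y n \<omega>) t - kernel_smooth k (b n) a (cdf P) t\<bar>
              \<le> inverse (b n) * (Ck * (Ckm * rate n))"
            using bn by (simp add: abs_mult mult_left_mono)
          let ?D = "kernel_smooth k (b n) a (sub_empirical T Y n \<omega>) t
            - expectation (\<lambda>\<omega>. kernel_smooth k (b n) a (sub_empirical T Y n \<omega>) t)"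
          have "\<bar>?I (event_measure T Y n \<omega>) - ?I sub_law\<bar> \<le> Ck * (5 * rate n)"
            by (rule Ck(2)[rule_format, OF finite_borel_measure_event_measure finite_borel_measure_sub_law _ A bn tu])
              (simp add: cdf_event_measure se)
          moreover have "?D = inverse (b n) * (?I (event_measure T Y n \<omega>) - ?I sub_law)"
            unfolding expectation_kernel_smooth_sub_empirical[OF k K[rule_format] \<open>1 \<le> n\<close>]
            unfolding kernel_smooth_def interval_measure_sub_empirical
            by (simp only: right_diff_distrib)
          ultimately have D: "\<bar>?D\<bar> \<le> inverse (b n) * (Ck * (5 * rate n))"
            using bn by (simp add: abs_mult mult_left_mono)
          have gt: "g \<le> 1 - cdf Q t"
            unfolding g_def using t u by (intro diff_left_mono Q.cdf_nondecreasing) simp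
          have "\<bar>?D / (1 - cdf Q t)\<bar> = \<bar>?D\<bar> / (1 - cdf Q t)"
            using g gt by (simp add: abs_divide)
          also have "\<dots> \<le> inverse (b n) * (Ck * (5 * rate n)) / g"
            using D gt g Ck(1) e0 bn by (intro frac_le) auto
          finally have second: "\<bar>?D / (1 - cdf Q t)\<bar> \<le> inverse (b n) * (Ck * (5 * rate n)) / g" .
          have "inverse (b n) * (Ck * (Ckm * rate n)) + inverse (b n) * (Ck * (5 * rate n)) / g
              = (Ck * Ckm + Ck * 5 / g) * (inverse (b n) * rate n)"
            by (simp add: algebra_simps)
          then show "\<bar>kernel_smooth k (b n) a (kaplan_meier T Y n \<omega>) t - kernel_smooth k (b n) a (cdf P) t
              - ?D / (1 - cdf Q t)\<bar> \<le> (Ck * Ckm + Ck * 5 / g) * (inverse (b n) * sqrt (ln (real n) / real n))"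
            using first second unfolding rate_def by linarith
        qed
      qed
    qed
  qed
qed

end

text \<open>
  The set has to be nonempty, since the supremum of the empty set is \<open>- \<infinity>\<close>, of infinite absolute
  value.
\<close>

lemma as_bigo_SUP_I:
  fixes Z :: "nat \<Rightarrow> 'a \<Rightarrow> real \<Rightarrow> real" and S :: "real set"
  assumes bound: "AE \<omega> in M. \<forall>\<^sub>F n in sequentially. \<forall>t\<in>S. \<bar>Z n \<omega> t\<bar> \<le> C * a n"
    and S: "S \<noteq> {}" and a: "\<forall>\<^sub>F n in sequentially. 0 < a n"
  shows "as_bigo M (\<lambda>n \<omega>. SUP t\<in>S. ereal \<bar>Z n \<omega> t\<bar>) a"
  unfolding as_bigo_def using bound
proof eventually_elim
  case (elim \<omega>)
  have "\<forall>\<^sub>F n in sequentially. \<bar>SUP t\<in>S. ereal \<bar>Z n \<omega> t\<bar>\<bar> / ereal (a n) \<le> ereal C"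
    using elim a
  proof eventually_elim
    case (elim n)
    obtain t0 where t0: "t0 \<in> S" using S by blast
    have "(SUP t\<in>S. ereal \<bar>Z n \<omega> t\<bar>) \<le> ereal (C * a n)" using elim by (intro SUP_least) auto
    moreover have "0 \<le> (SUP t\<in>S. ereal \<bar>Z n \<omega> t\<bar>)" by (rule SUP_upper2[OF t0]) simp
    ultimately have "\<bar>SUP t\<in>S. ereal \<bar>Z n \<omega> t\<bar>\<bar> \<le> ereal (C * a n)" by simp
    then have "\<bar>SUP t\<in>S. ereal \<bar>Z n \<omega> t\<bar>\<bar> / ereal (a n) \<le> ereal (C * a n) / ereal (a n)"
      using elim by (intro ereal_divide_right_mono) auto
    also have "\<dots> = ereal C" using elim by simp
    finally show ?case .
  qed
  then have "limsup (\<lambda>n. \<bar>SUP t\<in>S. ereal \<bar>Z n \<omega> t\<bar>\<bar> / ereal (a n)) \<le> ereal C" by (rule Limsup_bounded)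
  then show ?case by (rule order.strict_trans1) simp
qed

theorem theorem1:
  fixes M :: "'a measure"
    and T Y :: "nat \<Rightarrow> 'a \<Rightarrow> real"
    and F G L f g k :: "real \<Rightarrow> real"
    and r s \<tau> :: real
    and b :: "nat \<Rightarrow> real"
  assumes "prob_space M"
    and "\<forall>i\<ge>1. T i \<in> borel_measurable M" and "\<forall>i\<ge>1. Y i \<in> borel_measurable M"
    and "\<forall>i\<ge>1. AE \<omega> in M. 0 \<le> T i \<omega>" and "\<forall>i\<ge>1. AE \<omega> in M. 0 \<le> Y i \<omega>"
    and "neg_assoc_seq M T" and "neg_assoc_seq M Y"
    and "prob_space.indep_var M
           (Pi\<^sub>M {1..} (\<lambda>_. borel)) (\<lambda>\<omega>. \<lambda>i\<in>{1..}. T i \<omega>)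
           (Pi\<^sub>M {1..} (\<lambda>_. borel)) (\<lambda>\<omega>. \<lambda>i\<in>{1..}. Y i \<omega>)"
    and "\<forall>i\<ge>1. cdf (distr M borel (T i)) = F" and "continuous_on UNIV F"
    and "\<forall>x. 0 \<le> f x" and "\<forall>i\<ge>1. distributed M lborel (T i) (\<lambda>x. ennreal (f x))"
    and "\<forall>i\<ge>1. cdf (distr M borel (Y i)) = G"
    and "\<forall>x. 0 \<le> g x" and "\<forall>i\<ge>1. distributed M lborel (Y i) (\<lambda>x. ennreal (g x))"
    and "AE x in lborel. (G has_real_derivative g x) (at x)"
    and "\<forall>i\<ge>1. cdf (distr M borel (obs_time T Y i)) = L"
    and "prob_density k" and "r < 0" and "0 < s"
    and "bounded_variation_on {r<..<s} k" and "\<forall>t. t \<notin> {r<..<s} \<longrightarrow> k t = 0"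
    and "lower_end F < ereal \<tau>" and "ereal \<tau> < upper_end L"
    and "bounded (f ` {0..\<tau>})" and "bounded (g ` {0..\<tau>})"
    and "\<forall>n\<ge>1. 0 < b n" and "b \<longlonglongrightarrow> 0"
    and "(\<lambda>n. inverse (b n)) \<in> o(\<lambda>n. sqrt (real n / ln (real n)))"
  defines "ftilde \<equiv> \<lambda>n \<omega>. kernel_smooth k (b n) (lower_end F) (kaplan_meier T Y n \<omega>)"
    and "fn \<equiv> \<lambda>n. kernel_smooth k (b n) (lower_end F) F"
    and "fstar \<equiv> \<lambda>n \<omega>. kernel_smooth k (b n) (lower_end F) (sub_empirical T Y n \<omega>)"
  shows "as_bigo M
           (\<lambda>n \<omega>. SUP t\<in>{0<..\<tau>}.
              ereal \<bar>ftilde n \<omega> t - fn n t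
                     - (fstar n \<omega> t - prob_space.expectation M (\<lambda>\<omega>'. fstar n \<omega>' t)) / (1 - G t)\<bar>)
           (\<lambda>n. inverse (b n) * sqrt (ln (real n) / real n))"
proof -
  interpret prob_space M by fact
  define P where "P = distr M borel (T 1)"
  define Q where "Q = distr M borel (Y 1)"
  have T: "T i \<in> borel_measurable M" and Y: "Y i \<in> borel_measurable M" if "1 \<le> i" for i
    using assms(2,3) that by auto
  have F: "F = cdf P" and G: "G = cdf Q" using assms(9,13) by (auto simp: P_def Q_def)
  interpret P: real_distribution P unfolding P_def by (rule real_distribution_distr) (simp add: T)
  interpret Q: real_distribution Q unfolding Q_def by (rule real_distribution_distr) (simp add: Y)
  have law_T: "distr M borel (T i) = P" if "1 \<le> i" for i
    using assms(9) that T F P.real_distribution_axioms by (intro cdf_unique real_distribution_distr) auto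
  have law_Y: "distr M borel (Y i) = Q" if "1 \<le> i" for i
    using assms(13) that Y G Q.real_distribution_axioms by (intro cdf_unique real_distribution_distr) auto
  have atomless_P: "measure P {x} = 0" for x
    using assms(10) unfolding F by (simp add: continuous_on_eq_continuous_at P.isCont_cdf)
  have atomless_Q: "measure Q {x} = 0" for x
  proof -
    have "distributed M lborel (Y 1) (\<lambda>x. ennreal (g x))" using assms(15) by simp
    then have gm: "(\<lambda>x. ennreal (g x)) \<in> borel_measurable lborel"
      and law: "distr M lborel (Y 1) = density lborel (\<lambda>x. ennreal (g x))"
      by (auto simp: distributed_def)
    have "Q = density lborel (\<lambda>x. ennreal (g x))"
      unfolding Q_def law[symmetric] by (intro distr_cong) auto
    moreover have "{x} \<in> null_sets (density lborel (\<lambda>x. ennreal (g x)))"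
    proof -
      have "AE y in lborel. y \<in> {x} \<longrightarrow> ennreal (g y) = 0"
        using AE_lborel_singleton[of x] by eventually_elim simp
      then show ?thesis by (subst null_sets_density_iff[OF gm]) simp
    qed
    ultimately show ?thesis by (simp add: measure_eq_0_null_sets)
  qed
  interpret C: na_censoring M T Y P Q
    using assms(6-8) T Y law_T law_Y atomless_P atomless_Q by unfold_locales auto
  \<comment> \<open>Nonnegative lifetimes give \<open>0 \<le> lower_end F < \<tau>\<close>, so that the supremum runs over a nonempty set.\<close>
  have "F t = 0" if "t < 0" for t
  proof -
    have "AE \<omega> in M. 0 \<le> T 1 \<omega>" using assms(4) by simp
    then have "AE x in P. 0 \<le> x" unfolding P_def using T[of 1] by (subst AE_distr_iff) auto
    then have "AE x in P. x \<notin> {..t}" by eventually_elim (use that in simp)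
    then have "P.prob {..t} = 0" by (subst P.prob_eq_0) auto
    then show ?thesis by (simp add: F cdf_def)
  qed
  then have F_pos: "0 \<le> t" if "0 < F t" for t using that by (metis less_irrefl not_le)
  have "0 \<le> lower_end F" unfolding lower_end_def
  proof (rule Inf_greatest)
    fix x assume "x \<in> {ereal t |t. 0 < F t}"
    then obtain t where "x = ereal t" "0 < F t" by blast
    then show "0 \<le> x" using F_pos by simp
  qed
  then have \<tau>: "0 < \<tau>" using assms(23) by (metis ereal_less(2) order.strict_trans1)
  \<comment> \<open>Half lines up to such a \<open>u\<close> leave room to the right of \<open>\<tau>\<close> for the kernel windows.\<close>
  obtain u where u: "\<tau> < u" "L u < 1"
    using assms(24) unfolding upper_end_def less_Sup_iff by auto
  have Lu: "L u = prob {\<omega>\<in>space M. min (T 1 \<omega>) (Y 1 \<omega>) \<le> u}"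
  proof -
    have "obs_time T Y 1 \<in> borel_measurable M" unfolding obs_time_def[abs_def] using T Y by measurable
    moreover have "L = cdf (distr M borel (obs_time T Y 1))" using assms(17) by simp
    ultimately show ?thesis
      by (simp add: cdf_def measure_distr obs_time_def vimage_def Int_def conj_commute)
  qed
  have m: "{\<omega>\<in>space M. min (T 1 \<omega>) (Y 1 \<omega>) \<le> u} \<in> events" using T[of 1] Y[of 1] by measurable
  have "cdf P u = prob {\<omega>\<in>space M. T 1 \<omega> \<le> u}"
    unfolding P_def cdf_def using T[of 1] by (simp add: measure_distr vimage_def Int_def conj_commute)
  also have "\<dots> \<le> L u" unfolding Lu by (intro finite_measure_mono m) auto
  finally have Pu: "cdf P u < 1" using u by simp
  have "cdf Q u = prob {\<omega>\<in>space M. Y 1 \<omega> \<le> u}"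
    unfolding Q_def cdf_def using Y[of 1] by (simp add: measure_distr vimage_def Int_def conj_commute)
  also have "\<dots> \<le> L u" unfolding Lu by (intro finite_measure_mono m) auto
  finally have Qu: "cdf Q u < 1" using u by simp
  have k: "k \<in> borel_measurable borel" using assms(18) by (simp add: prob_density_def)
  have supp: "\<And>x. x \<notin> {r<..<s} \<Longrightarrow> k x = 0" using assms(22) by blast
  have b: "\<And>n. 1 \<le> n \<Longrightarrow> 0 < b n" using assms(27) by blast
  obtain C where C: "AE \<omega> in M. \<forall>\<^sub>F n in sequentially. \<forall>t\<le>\<tau>.
    \<bar>ftilde n \<omega> t - fn n t - (fstar n \<omega> t - expectation (\<lambda>\<omega>'. fstar n \<omega>' t)) / (1 - G t)\<bar>
    \<le> C * (inverse (b n) * sqrt (ln (real n) / real n))"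
    unfolding ftilde_def fn_def fstar_def F G
    by (rule C.kernel_estimator_rate[OF k assms(21) assms(19,20) supp u(1) Pu Qu b assms(28)])
  show ?thesis
  proof (rule as_bigo_SUP_I)
    show "AE \<omega> in M. \<forall>\<^sub>F n in sequentially. \<forall>t\<in>{0<..\<tau>}.
      \<bar>ftilde n \<omega> t - fn n t - (fstar n \<omega> t - expectation (\<lambda>\<omega>'. fstar n \<omega>' t)) / (1 - G t)\<bar>
      \<le> C * (inverse (b n) * sqrt (ln (real n) / real n))"
      using C by (elim eventually_mono) (auto elim: eventually_mono)
    show "{0<..\<tau>} \<noteq> {}" using \<tau> by simp
    show "\<forall>\<^sub>F n in sequentially. 0 < inverse (b n) * sqrt (ln (real n) / real n)"
      using b by (intro eventually_sequentiallyI[of 2]) auto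
  qed
qed

end
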